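(* Assume that $G$ is a finitely generated group and that there exist $0<\gamma_1\le\gamma_2<1$ such that $$\exp(-n^{\gamma_2})\lesssim\Phi_G(n)\lesssim\exp(-n^{\gamma_1}).$$ Let $\rho:[0,\infty)\to[1,\infty)$ be a continuous increasing function with $$\rho(t)\simeq\left(\int_t^\infty\frac{ds}{(1+s)\ell(s)}\right)^{-1}$$ where $\ell:[0,\infty)\to[1,\infty)$ is continuous, increasing and regularly varying of some index $\ge0$, with $\int_0^\infty\frac{ds}{(1+s)\ell(s)}<\infty$, and assume that $\rho$ is a slowly varying function satisfying $\rho(t^a)\simeq\rho(t)$ for any $a>0$. Then $$\widetilde\Phi_{G,\rho}(n)\simeq\exp(-n/\rho(n)).$$
   Context: $G$ is equipped with a fixed finite symmetric generating set $S^*$ containing the identity $e$ and the associated word length $|\cdot|$; $\mathbf u$ is the uniform probability measure on $S^*$ and $\Phi_G$ is represented by $\Phi_G(n)=\mathbf u^{(n)}(e)$, where $\phi^{(n)}$ denotes the $n$-fold convolution power. For a probability measure $\mu$ on $G$, $W(\rho,\mu)=\sup_{s>0}\{s\,\mu(\{g:\rho(|g|)>s\})\}$ and $$\widetilde\Phi_{G,\rho}(n)=\inf\{\phi^{(2n)}(e):\phi\text{ symmetric probability measure on }G,\ W(\rho,\phi)\le2\rho(0)\}.$$ For monotone functions near infinity (on integers extended to reals by integer parts), $f\lesssim g$ means $f(t)\le c_1g(c_2t)$ for some constants $c_1,c_2\in(0,\infty)$, and $f\simeq g$ means $f\lesssim g$ and $g\lesssim f$. *)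

theory Defs
  imports "HOL-Probability.Probability" "HOL-Algebra.Generated_Groups"
begin

definition word_length :: "('a, 'b) monoid_scheme \<Rightarrow> 'a set \<Rightarrow> 'a \<Rightarrow> nat" where
  "word_length G S g =
     (LEAST n. \<exists>ws. length ws = n \<and> set ws \<subseteq> S \<and> foldr (mult G) ws \<one>\<^bsub>G\<^esub> = g)"

text \<open>
  A finitely generated group is countable, so its probability measures are exactly the
  probability mass functions whose support lies in the carrier.
\<close>

definition conv_pmf :: "('a, 'b) monoid_scheme \<Rightarrow> 'a pmf \<Rightarrow> 'a pmf \<Rightarrow> 'a pmf" where
  "conv_pmf G \<mu> \<nu> = map_pmf (\<lambda>(x, y). x \<otimes>\<^bsub>G\<^esub> y) (pair_pmf \<mu> \<nu>)"

primrec conv_power :: "('a, 'b) monoid_scheme \<Rightarrow> 'a pmf \<Rightarrow> nat \<Rightarrow> 'a pmf" where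
  "conv_power G \<mu> 0 = return_pmf \<one>\<^bsub>G\<^esub>"
| "conv_power G \<mu> (Suc n) = conv_pmf G \<mu> (conv_power G \<mu> n)"

definition symmetric_pmf_on :: "('a, 'b) monoid_scheme \<Rightarrow> 'a pmf \<Rightarrow> bool" where
  "symmetric_pmf_on G \<mu> \<longleftrightarrow>
     set_pmf \<mu> \<subseteq> carrier G \<and> (\<forall>g\<in>carrier G. pmf \<mu> (inv\<^bsub>G\<^esub> g) = pmf \<mu> g)"

definition return_prob :: "('a, 'b) monoid_scheme \<Rightarrow> 'a set \<Rightarrow> nat \<Rightarrow> real" where
  "return_prob G S n = pmf (conv_power G (pmf_of_set S) n) \<one>\<^bsub>G\<^esub>"

text \<open>The weak moment may be infinite, hence the extended reals.\<close>

definition weak_moment ::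
  "('a, 'b) monoid_scheme \<Rightarrow> 'a set \<Rightarrow> (real \<Rightarrow> real) \<Rightarrow> 'a pmf \<Rightarrow> ereal" where
  "weak_moment G S \<rho> \<mu> =
     (SUP s\<in>{0<..}. ereal (s * measure_pmf.prob \<mu>
        {g \<in> carrier G. \<rho> (real (word_length G S g)) > s}))"

text \<open>
  The set below contains the value at the Dirac mass at the identity (if \<open>\<rho> 0 \<ge> 0\<close>) and is bounded
  below by 0, so the real infimum is the true one.
\<close>

definition extremal_return_prob ::
  "('a, 'b) monoid_scheme \<Rightarrow> 'a set \<Rightarrow> (real \<Rightarrow> real) \<Rightarrow> nat \<Rightarrow> real" where
  "extremal_return_prob G S \<rho> n =
     Inf {pmf (conv_power G \<phi> (2 * n)) \<one>\<^bsub>G\<^esub> | \<phi>.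
            symmetric_pmf_on G \<phi> \<and> weak_moment G S \<rho> \<phi> \<le> ereal (2 * \<rho> 0)}"

definition floor_ext :: "(nat \<Rightarrow> real) \<Rightarrow> real \<Rightarrow> real" where
  "floor_ext f t = f (nat \<lfloor>t\<rfloor>)"

definition lesssim :: "(real \<Rightarrow> real) \<Rightarrow> (real \<Rightarrow> real) \<Rightarrow> bool" (infix "\<lesssim>" 50) where
  "f \<lesssim> g \<longleftrightarrow> (\<exists>c\<^sub>1>0. \<exists>c\<^sub>2>0. \<forall>\<^sub>F t in at_top. f t \<le> c\<^sub>1 * g (c\<^sub>2 * t))"

definition simeq_growth :: "(real \<Rightarrow> real) \<Rightarrow> (real \<Rightarrow> real) \<Rightarrow> bool" (infix "\<simeq>" 50) where
  "f \<simeq> g \<longleftrightarrow> f \<lesssim> g \<and> g \<lesssim> f"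

text \<open>
  Measurability, usually part of the definition of regular variation, is omitted: the notion is
  only applied to functions that are continuous on the half-line.
\<close>

definition regularly_varying :: "(real \<Rightarrow> real) \<Rightarrow> real \<Rightarrow> bool" where
  "regularly_varying f \<alpha> \<longleftrightarrow>
     (\<forall>\<^sub>F t in at_top. f t > 0) \<and>
     (\<forall>c>0. ((\<lambda>t. f (c * t) / f t) \<longlongrightarrow> c powr \<alpha>) at_top)"

definition slowly_varying :: "(real \<Rightarrow> real) \<Rightarrow> bool" where
  "slowly_varying f \<longleftrightarrow> regularly_varying f 0"

end

theory Submission
  imports Defs "HOL-Real_Asymp.Real_Asymp"
begin

text \<open>
  Convolution with a symmetric probability measure \<open>\<phi>\<close> is a self-adjoint contraction of \<open>\<ell>\<^sup>2\<close> of the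
  group.  Hence a probability measure \<open>p\<close> yields the lower bound
  \<open>\<phi>\<^sup>2\<^sup>n(e) \<ge> \<langle>p, p\<rangle> (\<langle>p, \<phi> p\<rangle> / \<langle>p, p\<rangle>)\<^sup>2\<^sup>n\<close> (\<open>return_ge_test_distribution\<close>).

  \<^emph>\<open>Lower bound.\<close>  Let \<open>p\<close> be the law of the simple walk at time \<open>n\<close>.  The loss
  \<open>1 - \<langle>p, \<phi> p\<rangle> / \<langle>p, p\<rangle>\<close> is the \<open>\<phi>\<close>-mean of the relative displacement of \<open>p\<close> under translations.
  It is at most 1 for every step, and at most \<open>r\<^sup>2\<close> times the loss for generators if the step has
  length at most \<open>r\<close> (\<open>return_ge_truncation\<close>).  The even return probabilities of the simple walk are
  log-convex and at least \<open>exp (- K n powr \<gamma>\<^sub>2)\<close>, so the loss for generators is at most of order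
  \<open>n powr (\<gamma>\<^sub>2 - 1)\<close>, a negative power of \<open>n\<close>.  If \<open>r\<close> is a small power of \<open>n\<close>, short steps therefore
  lose only a negative power of \<open>n\<close>.  Long steps have probability at most of order \<open>1 / \<rho> r\<close> by the weak
  moment condition, and \<open>\<rho> r\<close> is comparable to \<open>\<rho> n\<close>.  Over \<open>2 n\<close> steps this costs a factor
  \<open>exp (- C n / \<rho> n)\<close>, with a constant that does not depend on \<open>\<phi>\<close>, and the factor
  \<open>\<langle>p, p\<rangle> \<ge> exp (- K (2 n) powr \<gamma>\<^sub>2)\<close> is no worse (\<open>return_ge_of_weak_moment\<close>).

  \<^emph>\<open>Upper bound.\<close>  Let each step be a simple walk run for a random time \<open>N\<close> with
  \<open>P(N \<ge> r) = 1 / \<rho> r\<close>.  Its length is at most \<open>N\<close>, whence the weak moment condition.  If \<open>r\<close> is a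
  large power of \<open>n\<close>, the simple walk at any time beyond \<open>r\<close> returns with probability at most of
  order \<open>exp (- c n)\<close>, while all of \<open>2 n\<close> independent copies of \<open>N\<close> are below \<open>r\<close> with probability at most
  \<open>exp (- 2 n / \<rho> r)\<close>.  Again \<open>\<rho> r\<close> is comparable to \<open>\<rho> n\<close> (\<open>ex_return_le_of_weak_moment\<close>).
\<close>

section \<open>Collision probabilities\<close>

lemma integrable_indicator_pmf: "integrable (measure_pmf M) (indicator A :: 'a \<Rightarrow> real)"
  by (intro integrable_real_indicator) (simp_all add: measure_pmf.emeasure_eq_measure)

text \<open>
  The inner product of two mass functions in \<open>\<ell>\<^sup>2\<close>, as the probability that independent samples
  coincide.  In this form invariance under injective maps is immediate, and no summability has to
  be discussed.
\<close>

definition overlap :: "'a pmf \<Rightarrow> 'a pmf \<Rightarrow> real" where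
  "overlap \<mu> \<nu> = measure_pmf.prob (pair_pmf \<mu> \<nu>) {(x, y). x = y}"

lemma overlap_eq_pmf: "overlap \<mu> \<nu> = pmf (bind_pmf \<mu> (\<lambda>x. map_pmf ((=) x) \<nu>)) True"
proof -
  have "bind_pmf \<mu> (\<lambda>x. map_pmf ((=) x) \<nu>) = map_pmf (\<lambda>(x, y). x = y) (pair_pmf \<mu> \<nu>)"
    by (simp add: pair_pmf_def map_bind_pmf map_pmf_def bind_assoc_pmf bind_return_pmf)
  moreover have "(\<lambda>(x, y). x = y) -` {True} = {(x :: 'a, y). x = y}"
    by auto
  ultimately show ?thesis
    by (simp only: overlap_def pmf_map)
qed

lemma overlap_eq_expectation: "overlap \<mu> \<nu> = (\<integral>x. pmf \<nu> x \<partial>measure_pmf \<mu>)"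
proof -
  have "(=) x -` {True} = {x}" for x :: 'a
    by auto
  then show ?thesis
    by (simp add: overlap_eq_pmf pmf_bind pmf_map measure_pmf_single)
qed

lemma overlap_eq_integral: "overlap \<mu> \<nu> = (\<integral>x. pmf \<mu> x * pmf \<nu> x \<partial>count_space UNIV)"
  by (simp add: overlap_eq_expectation measure_pmf_eq_density integral_density)

lemma integrable_pmf_mult: "integrable (count_space UNIV) (\<lambda>x. pmf \<mu> x * pmf \<nu> x)"
proof (rule Bochner_Integration.integrable_bound[OF integrable_pmf])
  show "AE x in count_space UNIV. norm (pmf \<mu> x * pmf \<nu> x) \<le> norm (pmf \<mu> x)"
    by (simp add: mult_left_le pmf_le_1)
qed simp

lemma overlap_nonneg: "overlap \<mu> \<nu> \<ge> 0"
  by (simp add: overlap_def)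

lemma overlap_self_pos: "overlap \<mu> \<mu> > 0"
proof -
  obtain x where x: "x \<in> set_pmf \<mu>"
    using set_pmf_not_empty[of \<mu>] by blast
  then have "0 < pmf (pair_pmf \<mu> \<mu>) (x, x)"
    by (simp add: pmf_pair pmf_positive)
  also have "\<dots> \<le> overlap \<mu> \<mu>"
    unfolding overlap_def measure_pmf_single[symmetric]
    by (intro measure_pmf.finite_measure_mono) auto
  finally show ?thesis .
qed

lemma overlap_map_inj:
  assumes "inj_on f (set_pmf \<mu> \<union> set_pmf \<nu>)"
  shows "overlap (map_pmf f \<mu>) (map_pmf f \<nu>) = overlap \<mu> \<nu>"
proof -
  have "overlap (map_pmf f \<mu>) (map_pmf f \<nu>)
      = measure_pmf.prob (pair_pmf \<mu> \<nu>) ((\<lambda>(a, b). (f a, f b)) -` {(x, y). x = y})"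
    by (simp add: overlap_def map_pair[symmetric])
  also have "\<dots> = overlap \<mu> \<nu>"
    unfolding overlap_def
    using assms by (intro measure_pmf.finite_measure_eq_AE) (auto simp: AE_measure_pmf_iff inj_on_def)
  finally show ?thesis .
qed

lemma overlap_bind_pmf:
  "overlap \<mu> (bind_pmf \<phi> f) = (\<integral>h. overlap \<mu> (f h) \<partial>measure_pmf \<phi>)"
proof -
  have "bind_pmf \<mu> (\<lambda>x. map_pmf ((=) x) (bind_pmf \<phi> f))
      = bind_pmf \<phi> (\<lambda>h. bind_pmf \<mu> (\<lambda>x. map_pmf ((=) x) (f h)))"
    unfolding map_bind_pmf by (rule bind_commute_pmf)
  then show ?thesis
    by (simp add: overlap_eq_pmf pmf_bind[of \<phi>])
qed

lemma overlap_le: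
  assumes "\<And>x. pmf \<nu> x \<le> c"
  shows "overlap \<mu> \<nu> \<le> c"
proof -
  have "(\<integral>x. pmf \<nu> x \<partial>measure_pmf \<mu>) \<le> (\<integral>x. c \<partial>measure_pmf \<mu>)"
    using measure_pmf.integrable_const_bound[where B = 1 and f = "pmf \<nu>"]
    by (intro integral_mono) (auto simp: assms pmf_le_1)
  then show ?thesis
    by (simp add: overlap_eq_expectation)
qed

text \<open>
  The quadratic form behind both the Cauchy--Schwarz inequality and the squared distance.
\<close>

lemma overlap_combination:
  "(\<integral>x. (a * pmf \<mu> x - b * pmf \<nu> x)\<^sup>2 \<partial>count_space UNIV)
     = a\<^sup>2 * overlap \<mu> \<mu> - 2 * a * b * overlap \<mu> \<nu> + b\<^sup>2 * overlap \<nu> \<nu>"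
  "integrable (count_space UNIV) (\<lambda>x. (a * pmf \<mu> x - b * pmf \<nu> x)\<^sup>2)"
proof -
  have eq: "(\<lambda>x. (a * pmf \<mu> x - b * pmf \<nu> x)\<^sup>2)
     = (\<lambda>x. a\<^sup>2 * (pmf \<mu> x * pmf \<mu> x) - 2 * a * b * (pmf \<mu> x * pmf \<nu> x)
             + b\<^sup>2 * (pmf \<nu> x * pmf \<nu> x))"
    by (auto simp: fun_eq_iff power2_eq_square algebra_simps)
  show "(\<integral>x. (a * pmf \<mu> x - b * pmf \<nu> x)\<^sup>2 \<partial>count_space UNIV)
     = a\<^sup>2 * overlap \<mu> \<mu> - 2 * a * b * overlap \<mu> \<nu> + b\<^sup>2 * overlap \<nu> \<nu>"
    unfolding eq overlap_eq_integral
    by (simp add: integrable_pmf_mult)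
  show "integrable (count_space UNIV) (\<lambda>x. (a * pmf \<mu> x - b * pmf \<nu> x)\<^sup>2)"
    unfolding eq by (simp add: integrable_pmf_mult)
qed

lemma overlap_Cauchy_Schwarz: "(overlap \<mu> \<nu>)\<^sup>2 \<le> overlap \<mu> \<mu> * overlap \<nu> \<nu>"
proof -
  let ?A = "overlap \<mu> \<mu>" and ?B = "overlap \<mu> \<nu>" and ?C = "overlap \<nu> \<nu>"
  \<comment> \<open>The square of \<open>?C \<mu> - ?B \<nu>\<close>, a multiple of the component of \<open>\<mu>\<close> orthogonal to \<open>\<nu>\<close>.\<close>
  have "0 \<le> ?C\<^sup>2 * ?A - 2 * ?C * ?B * ?B + ?B\<^sup>2 * ?C"
    unfolding overlap_combination(1)[symmetric] by simp
  also have "\<dots> = ?C * (?A * ?C - ?B\<^sup>2)"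
    by (simp add: power2_eq_square algebra_simps)
  finally show ?thesis
    using overlap_self_pos[of \<nu>] by (simp add: zero_le_mult_iff)
qed

definition sq_dist :: "'a pmf \<Rightarrow> 'a pmf \<Rightarrow> real" where
  "sq_dist \<mu> \<nu> = (\<integral>x. (pmf \<mu> x - pmf \<nu> x)\<^sup>2 \<partial>count_space UNIV)"

lemma sq_dist_eq_overlap: "sq_dist \<mu> \<nu> = overlap \<mu> \<mu> - 2 * overlap \<mu> \<nu> + overlap \<nu> \<nu>"
  using overlap_combination(1)[of 1 \<mu> 1 \<nu>] by (simp add: sq_dist_def)

text \<open>
  The triangle inequality for squared distances, with a free weight \<open>r\<close>: the choice
  \<open>r = n\<close> turns the bounds \<open>D\<close> and \<open>n\<^sup>2 D\<close> for the two legs into \<open>(n + 1)\<^sup>2 D\<close>, so that path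
  lengths enter quadratically.
\<close>

lemma sq_dist_triangle:
  assumes "r > 0"
  shows "sq_dist \<mu> \<xi> \<le> (1 + r) * sq_dist \<mu> \<nu> + (1 + 1 / r) * sq_dist \<nu> \<xi>"
proof -
  have int: "integrable (count_space UNIV) (\<lambda>x. (pmf \<alpha> x - pmf \<beta> x)\<^sup>2)" for \<alpha> \<beta> :: "'a pmf"
    using overlap_combination(2)[of 1 \<alpha> 1 \<beta>] by simp
  have young: "(a + b)\<^sup>2 \<le> (1 + r) * a\<^sup>2 + (1 + 1 / r) * b\<^sup>2" for a b :: real
  proof -
    have "(1 + r) * a\<^sup>2 + (1 + 1 / r) * b\<^sup>2 - (a + b)\<^sup>2 = (r * a - b)\<^sup>2 / r"
      using assms by (simp add: field_simps power2_eq_square)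
    then show ?thesis
      using assms by (smt (verit) divide_nonneg_pos zero_le_power2)
  qed
  have "sq_dist \<mu> \<xi> \<le> (\<integral>x. (1 + r) * (pmf \<mu> x - pmf \<nu> x)\<^sup>2
      + (1 + 1 / r) * (pmf \<nu> x - pmf \<xi> x)\<^sup>2 \<partial>count_space UNIV)"
    unfolding sq_dist_def
  proof (rule integral_mono)
    show "(pmf \<mu> x - pmf \<xi> x)\<^sup>2 \<le> (1 + r) * (pmf \<mu> x - pmf \<nu> x)\<^sup>2
        + (1 + 1 / r) * (pmf \<nu> x - pmf \<xi> x)\<^sup>2" for x
      using young[of "pmf \<mu> x - pmf \<nu> x" "pmf \<nu> x - pmf \<xi> x"] by simp
  qed (simp_all add: int)
  also have "\<dots> = (1 + r) * sq_dist \<mu> \<nu> + (1 + 1 / r) * sq_dist \<nu> \<xi>"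
    unfolding sq_dist_def by (simp add: int)
  finally show ?thesis .
qed

section \<open>Convolution on a group\<close>

lemma conv_pmf_eq_bind_left:
  "conv_pmf G \<mu> \<nu> = bind_pmf \<mu> (\<lambda>x. map_pmf (\<lambda>y. x \<otimes>\<^bsub>G\<^esub> y) \<nu>)"
  by (simp add: conv_pmf_def pair_pmf_def map_bind_pmf map_pmf_def bind_assoc_pmf bind_return_pmf)

lemma conv_pmf_eq_bind_right:
  "conv_pmf G \<mu> \<nu> = bind_pmf \<nu> (\<lambda>y. map_pmf (\<lambda>x. x \<otimes>\<^bsub>G\<^esub> y) \<mu>)"
  unfolding conv_pmf_eq_bind_left map_pmf_def by (rule bind_commute_pmf)

lemma set_conv_pmf:
  "set_pmf (conv_pmf G \<mu> \<nu>) = (\<lambda>(x, y). x \<otimes>\<^bsub>G\<^esub> y) ` (set_pmf \<mu> \<times> set_pmf \<nu>)"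
  by (simp add: conv_pmf_def)

lemma pmf_map_inj_le:
  assumes "inj_on f (set_pmf M)" and "\<And>y. pmf M y \<le> c"
  shows "pmf (map_pmf f M) z \<le> c"
proof (cases "z \<in> f ` set_pmf M")
  case True
  then show ?thesis
    using assms by (auto simp: pmf_map_inj)
next
  case False
  have "0 \<le> c"
    by (rule order_trans[OF pmf_nonneg assms(2)])
  then show ?thesis
    using False by (simp add: pmf_map_outside)
qed

lemma pmf_bind_le:
  assumes "\<And>x. x \<in> set_pmf M \<Longrightarrow> pmf (f x) z \<le> c"
  shows "pmf (bind_pmf M f) z \<le> c"
proof -
  have "(\<integral>x. pmf (f x) z \<partial>measure_pmf M) \<le> (\<integral>x. c \<partial>measure_pmf M)"
    using measure_pmf.integrable_const_bound[where B = 1 and f = "\<lambda>x. pmf (f x) z"]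
    by (intro integral_mono_AE) (auto simp: assms pmf_le_1 AE_measure_pmf_iff)
  then show ?thesis
    by (simp add: pmf_bind)
qed

context group
begin

abbreviation supported :: "'a pmf \<Rightarrow> bool" where
  "supported \<mu> \<equiv> set_pmf \<mu> \<subseteq> carrier G"

abbreviation conv :: "'a pmf \<Rightarrow> 'a pmf \<Rightarrow> 'a pmf" (infixl "\<diamondop>" 70) where
  "\<mu> \<diamondop> \<nu> \<equiv> conv_pmf G \<mu> \<nu>"

abbreviation reversed :: "'a pmf \<Rightarrow> 'a pmf" where
  "reversed \<mu> \<equiv> map_pmf (m_inv G) \<mu>"

lemma supported_conv: "supported \<mu> \<Longrightarrow> supported \<nu> \<Longrightarrow> supported (\<mu> \<diamondop> \<nu>)"
  by (auto simp: set_conv_pmf)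

lemma supported_reversed: "supported \<mu> \<Longrightarrow> supported (reversed \<mu>)"
  by auto

lemma conv_assoc:
  assumes "supported \<mu>" "supported \<nu>" "supported \<xi>"
  shows "\<mu> \<diamondop> \<nu> \<diamondop> \<xi> = \<mu> \<diamondop> (\<nu> \<diamondop> \<xi>)"
proof -
  have "\<mu> \<diamondop> \<nu> \<diamondop> \<xi> = bind_pmf \<mu> (\<lambda>x. bind_pmf \<nu> (\<lambda>y. map_pmf (\<lambda>z. (x \<otimes> y) \<otimes> z) \<xi>))"
    by (simp add: conv_pmf_eq_bind_left bind_assoc_pmf bind_map_pmf)
  also have "\<dots> = bind_pmf \<mu> (\<lambda>x. bind_pmf \<nu> (\<lambda>y. map_pmf (\<lambda>z. x \<otimes> (y \<otimes> z)) \<xi>))"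
    using assms by (intro bind_pmf_cong refl map_pmf_cong) (auto intro!: m_assoc)
  also have "\<dots> = \<mu> \<diamondop> (\<nu> \<diamondop> \<xi>)"
    by (simp add: conv_pmf_eq_bind_left map_bind_pmf pmf.map_comp o_def)
  finally show ?thesis .
qed

lemma conv_one_left: "supported \<mu> \<Longrightarrow> return_pmf \<one> \<diamondop> \<mu> = \<mu>"
proof -
  assume "supported \<mu>"
  then have "map_pmf (\<lambda>y. \<one> \<otimes> y) \<mu> = map_pmf (\<lambda>y. y) \<mu>"
    by (intro map_pmf_cong) auto
  then show ?thesis
    by (simp add: conv_pmf_eq_bind_left bind_return_pmf)
qed

lemma conv_one_right: "supported \<mu> \<Longrightarrow> \<mu> \<diamondop> return_pmf \<one> = \<mu>"
proof -
  assume "supported \<mu>"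
  then have "map_pmf (\<lambda>y. y \<otimes> \<one>) \<mu> = map_pmf (\<lambda>y. y) \<mu>"
    by (intro map_pmf_cong) auto
  then show ?thesis
    by (simp add: conv_pmf_eq_bind_right bind_return_pmf)
qed

lemma supported_conv_power: "supported \<mu> \<Longrightarrow> supported (conv_power G \<mu> n)"
proof (induction n)
  case (Suc n)
  then show ?case
    using supported_conv[of \<mu> "conv_power G \<mu> n"] by simp
qed simp

lemma conv_power_add:
  assumes "supported \<mu>"
  shows "conv_power G \<mu> (m + n) = conv_power G \<mu> m \<diamondop> conv_power G \<mu> n"
proof (induction m)
  case 0
  show ?case
    by (simp add: assms conv_one_left supported_conv_power)
next
  case (Suc m)
  then show ?case
    using assms by (simp add: conv_assoc supported_conv_power)
qed

lemma reversed_conv: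
  assumes "supported \<mu>" "supported \<nu>"
  shows "reversed (\<mu> \<diamondop> \<nu>) = reversed \<nu> \<diamondop> reversed \<mu>"
proof -
  have "reversed (\<mu> \<diamondop> \<nu>) = bind_pmf \<mu> (\<lambda>x. map_pmf (\<lambda>y. inv (x \<otimes> y)) \<nu>)"
    by (simp add: conv_pmf_eq_bind_left map_bind_pmf pmf.map_comp o_def)
  also have "\<dots> = bind_pmf \<mu> (\<lambda>x. map_pmf (\<lambda>y. inv y \<otimes> inv x) \<nu>)"
    using assms by (intro bind_pmf_cong refl map_pmf_cong) (auto intro!: inv_mult_group)
  also have "\<dots> = reversed \<nu> \<diamondop> reversed \<mu>"
    by (simp add: conv_pmf_eq_bind_right bind_map_pmf pmf.map_comp o_def)
  finally show ?thesis .
qed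

lemma symmetric_pmf_on_iff_reversed: "symmetric_pmf_on G \<mu> \<longleftrightarrow> supported \<mu> \<and> reversed \<mu> = \<mu>"
proof (cases "supported \<mu>")
  case True
  have *: "pmf (reversed \<mu>) g = pmf \<mu> (inv g)" if "g \<in> carrier G" for g
  proof -
    have "measure_pmf.prob \<mu> (m_inv G -` {g}) = measure_pmf.prob \<mu> {inv g}"
      using True that by (intro measure_pmf.finite_measure_eq_AE) (auto simp: AE_measure_pmf_iff)
    then show ?thesis
      by (simp add: pmf_map measure_pmf_single)
  qed
  have "reversed \<mu> = \<mu>" if "\<forall>g\<in>carrier G. pmf \<mu> (inv g) = pmf \<mu> g"
  proof (rule pmf_eqI)
    fix g
    show "pmf (reversed \<mu>) g = pmf \<mu> g"
    proof (cases "g \<in> carrier G")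
      case False
      then have "g \<notin> set_pmf \<mu>" "g \<notin> set_pmf (reversed \<mu>)"
        using True supported_reversed[OF True] by blast+
      then show ?thesis
        unfolding set_pmf_iff by simp
    qed (simp add: * that)
  qed
  moreover have "\<forall>g\<in>carrier G. pmf \<mu> (inv g) = pmf \<mu> g" if "reversed \<mu> = \<mu>"
    using * by (metis that)
  ultimately show ?thesis
    using True by (auto simp: symmetric_pmf_on_def)
qed (simp add: symmetric_pmf_on_def)

lemma reversed_conv_power:
  assumes "symmetric_pmf_on G \<mu>"
  shows "reversed (conv_power G \<mu> n) = conv_power G \<mu> n"
proof (induction n)
  case (Suc n)
  have \<mu>: "supported \<mu>" "reversed \<mu> = \<mu>"
    using assms by (simp_all add: symmetric_pmf_on_iff_reversed)
  then have "reversed (conv_power G \<mu> (Suc n)) = conv_power G \<mu> n \<diamondop> conv_power G \<mu> 1"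
    by (simp add: reversed_conv supported_conv_power Suc conv_one_right)
  also have "\<dots> = conv_power G \<mu> (Suc n)"
    using conv_power_add[of \<mu> n 1] \<mu> by simp
  finally show ?case .
qed simp

lemma symmetric_conv_power: "symmetric_pmf_on G \<mu> \<Longrightarrow> symmetric_pmf_on G (conv_power G \<mu> n)"
  unfolding symmetric_pmf_on_iff_reversed
  by (metis reversed_conv_power supported_conv_power symmetric_pmf_on_iff_reversed)

text \<open>
  Return probabilities are inner products; through this identity the associativity of convolution
  becomes the self-adjointness of convolution operators.
\<close>

lemma pmf_reversed_conv_one:
  assumes "supported \<mu>" "supported \<nu>"
  shows "pmf (reversed \<mu> \<diamondop> \<nu>) \<one> = overlap \<mu> \<nu>"
proof -
  have "pmf (reversed \<mu> \<diamondop> \<nu>) \<one>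
      = measure_pmf.prob (pair_pmf \<mu> \<nu>) ((\<lambda>(x, y). inv x \<otimes> y) -` {\<one>})"
    by (simp add: conv_pmf_def pair_map_pmf1 pmf_map pmf.map_comp vimage_def case_prod_unfold)
  also have "\<dots> = overlap \<mu> \<nu>"
    unfolding overlap_def
    using assms by (intro measure_pmf.finite_measure_eq_AE)
      (auto simp: AE_measure_pmf_iff inv_solve_left' subset_iff)
  finally show ?thesis .
qed

lemma overlap_self_adjoint:
  assumes "symmetric_pmf_on G \<phi>" "supported \<mu>" "supported \<nu>"
  shows "overlap (\<phi> \<diamondop> \<mu>) \<nu> = overlap \<mu> (\<phi> \<diamondop> \<nu>)"
proof -
  have \<phi>: "supported \<phi>" "reversed \<phi> = \<phi>"
    using assms(1) by (simp_all add: symmetric_pmf_on_iff_reversed)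
  have "overlap (\<phi> \<diamondop> \<mu>) \<nu> = pmf (reversed (\<phi> \<diamondop> \<mu>) \<diamondop> \<nu>) \<one>"
    using \<phi> assms by (simp add: pmf_reversed_conv_one supported_conv)
  also have "\<dots> = pmf (reversed \<mu> \<diamondop> (\<phi> \<diamondop> \<nu>)) \<one>"
    using \<phi> assms conv_assoc[OF supported_reversed] by (simp add: reversed_conv)
  also have "\<dots> = overlap \<mu> (\<phi> \<diamondop> \<nu>)"
    using \<phi> assms by (simp add: pmf_reversed_conv_one supported_conv)
  finally show ?thesis .
qed

lemma pmf_conv_le:
  assumes "supported \<mu>" "supported \<psi>" "\<And>x. pmf \<psi> x \<le> c"
  shows "pmf (\<mu> \<diamondop> \<psi>) z \<le> c" and "pmf (\<psi> \<diamondop> \<mu>) z \<le> c"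
proof -
  have "inj_on (\<lambda>y. x \<otimes> y) (set_pmf \<psi>)" "inj_on (\<lambda>y. y \<otimes> x) (set_pmf \<psi>)"
    if "x \<in> carrier G" for x
    using that assms(2) by (auto simp: inj_on_def subset_iff)
  then show "pmf (\<mu> \<diamondop> \<psi>) z \<le> c" "pmf (\<psi> \<diamondop> \<mu>) z \<le> c"
    using assms unfolding conv_pmf_eq_bind_left[of G \<mu> \<psi>] conv_pmf_eq_bind_right[of G \<psi> \<mu>]
    by (auto intro!: pmf_bind_le pmf_map_inj_le)
qed

lemma return_even_eq_overlap:
  assumes "symmetric_pmf_on G \<phi>"
  shows "pmf (conv_power G \<phi> (2 * n)) \<one> = overlap (conv_power G \<phi> n) (conv_power G \<phi> n)"
proof -
  have \<phi>: "supported \<phi>"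
    using assms by (simp add: symmetric_pmf_on_iff_reversed)
  have "pmf (conv_power G \<phi> (2 * n)) \<one>
      = pmf (reversed (conv_power G \<phi> n) \<diamondop> conv_power G \<phi> n) \<one>"
    by (simp add: reversed_conv_power assms mult_2 conv_power_add \<phi>)
  then show ?thesis
    by (simp add: pmf_reversed_conv_one supported_conv_power \<phi>)
qed

text \<open>
  The value at \<open>z\<close> is the inner product of \<open>\<phi>\<^sup>n\<close> with a translate of itself, to which the
  Cauchy--Schwarz inequality applies.  For odd powers this fails.
\<close>

lemma pmf_even_conv_power_le:
  assumes "symmetric_pmf_on G \<phi>"
  shows "pmf (conv_power G \<phi> (2 * n)) z \<le> pmf (conv_power G \<phi> (2 * n)) \<one>"
proof (cases "z \<in> carrier G")
  case True
  have \<phi>: "supported \<phi>"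
    using assms by (simp add: symmetric_pmf_on_iff_reversed)
  let ?\<mu> = "conv_power G \<phi> n" and ?T = "map_pmf (\<lambda>x. x \<otimes> inv z) (conv_power G \<phi> n)"
  have \<mu>: "supported ?\<mu>" "reversed ?\<mu> = ?\<mu>"
    using assms by (simp_all add: supported_conv_power reversed_conv_power \<phi>)
  then have T: "supported ?T"
    using True by auto
  have eq: "?T = ?\<mu> \<diamondop> return_pmf (inv z)"
    by (simp add: conv_pmf_eq_bind_right bind_return_pmf)
  have inj: "inj_on (\<lambda>x. x \<otimes> inv z) (carrier G)"
    using True by (auto simp: inj_on_def)
  have "pmf (conv_power G \<phi> (2 * n)) z
      = pmf (map_pmf (\<lambda>x. x \<otimes> inv z) (?\<mu> \<diamondop> ?\<mu>)) \<one>"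
  proof -
    have "measure_pmf.prob (?\<mu> \<diamondop> ?\<mu>) ((\<lambda>x. x \<otimes> inv z) -` {\<one>})
        = measure_pmf.prob (?\<mu> \<diamondop> ?\<mu>) {z}"
      using True supported_conv[OF \<mu>(1) \<mu>(1)]
      by (intro measure_pmf.finite_measure_eq_AE)
        (auto simp: AE_measure_pmf_iff inv_solve_right' subset_iff)
    then show ?thesis
      by (simp add: pmf_map mult_2 conv_power_add \<phi> measure_pmf_single)
  qed
  also have "\<dots> = pmf (reversed ?\<mu> \<diamondop> ?T) \<one>"
    unfolding eq using True \<mu>
    by (simp add: conv_assoc[symmetric])
      (simp add: conv_pmf_eq_bind_right[of G _ "return_pmf _"] bind_return_pmf)
  also have "\<dots> = overlap ?\<mu> ?T"
    using \<mu>(1) T by (rule pmf_reversed_conv_one)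
  also have "\<dots> \<le> overlap ?\<mu> ?\<mu>"
  proof (rule power2_le_imp_le)
    have "overlap ?T ?T = overlap ?\<mu> ?\<mu>"
      using \<mu> by (intro overlap_map_inj inj_on_subset[OF inj]) auto
    then show "(overlap ?\<mu> ?T)\<^sup>2 \<le> (overlap ?\<mu> ?\<mu>)\<^sup>2"
      using overlap_Cauchy_Schwarz[of ?\<mu> ?T] by (simp add: power2_eq_square)
  qed (rule overlap_nonneg)
  finally show ?thesis
    by (simp add: return_even_eq_overlap assms)
next
  case False
  then have "z \<notin> set_pmf (conv_power G \<phi> (2 * n))"
    using supported_conv_power assms by (auto simp: symmetric_pmf_on_iff_reversed)
  then show ?thesis
    unfolding set_pmf_iff by simp
qed

end

section \<open>Log-convex sequences\<close>

text \<open>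
  The numbers \<open>\<parallel>P\<^sup>k f\<parallel>\<^sup>2\<close> of a self-adjoint operator \<open>P\<close> form such a sequence.  Its increasing ratios
  give geometric bounds: from below by the first ratio, from above by the last one.
\<close>

locale log_convex_sequence =
  fixes b :: "nat \<Rightarrow> real"
  assumes pos: "b k > 0"
    and log_convex: "(b (Suc k))\<^sup>2 \<le> b k * b (Suc (Suc k))"
begin

lemma ratio_mono:
  assumes "i \<le> j"
  shows "b (Suc i) / b i \<le> b (Suc j) / b j"
proof (rule lift_Suc_mono_le[OF _ assms])
  show "b (Suc k) / b k \<le> b (Suc (Suc k)) / b (Suc k)" for k
    using pos[of k] pos[of "Suc k"] log_convex[of k]
    by (simp add: divide_simps power2_eq_square mult.commute)
qed

lemma lower_geometric: "b 0 * (b 1 / b 0) ^ n \<le> b n"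
proof (induction n)
  case (Suc n)
  have "b 0 * (b 1 / b 0) ^ Suc n = (b 0 * (b 1 / b 0) ^ n) * (b 1 / b 0)"
    by simp
  also have "\<dots> \<le> b n * (b (Suc n) / b n)"
    using ratio_mono[of 0 n] pos[of 0] pos[of 1] pos[of n] Suc
    by (intro mult_mono) (auto intro: less_imp_le)
  also have "\<dots> = b (Suc n)"
    using pos[of n] by simp
  finally show ?case .
qed simp

lemma upper_geometric: "b m \<le> b 0 * (b (Suc m) / b m) ^ m"
proof -
  have "b k \<le> b 0 * (b (Suc m) / b m) ^ k" if "k \<le> m" for k
    using that
  proof (induction k)
    case (Suc k)
    have "b (Suc k) = b k * (b (Suc k) / b k)"
      using pos[of k] by simp
    also have "\<dots> \<le> (b 0 * (b (Suc m) / b m) ^ k) * (b (Suc m) / b m)"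
      using ratio_mono[of k m] pos Suc
      by (intro mult_mono) (auto intro: less_imp_le simp: pos)
    finally show ?case
      by (simp add: mult_ac)
  qed simp
  then show ?thesis
    by simp
qed

end

section \<open>Return probabilities and test distributions\<close>

context group
begin

lemma conv_power_Suc_conv:
  assumes "supported \<phi>" "supported p"
  shows "conv_power G \<phi> (Suc k) \<diamondop> p = \<phi> \<diamondop> (conv_power G \<phi> k \<diamondop> p)"
  using assms by (simp add: conv_assoc supported_conv_power)

text \<open>
  By self-adjointness one convolution moves across:
  \<open>\<langle>\<phi>\<^sup>k\<^sup>+\<^sup>1 p, \<phi>\<^sup>k\<^sup>+\<^sup>1 p\<rangle> = \<langle>\<phi>\<^sup>k p, \<phi>\<^sup>k\<^sup>+\<^sup>2 p\<rangle>\<close>.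
\<close>

lemma log_convex_overlap_conv_power:
  assumes "symmetric_pmf_on G \<phi>" "supported p"
  shows "log_convex_sequence
    (\<lambda>k. overlap (conv_power G \<phi> k \<diamondop> p) (conv_power G \<phi> k \<diamondop> p))"
proof
  fix k
  have \<phi>: "supported \<phi>"
    using assms by (simp add: symmetric_pmf_on_iff_reversed)
  define q where "q k = conv_power G \<phi> k \<diamondop> p" for k
  have q_Suc: "q (Suc k) = \<phi> \<diamondop> q k" and q: "supported (q k)" for k
    using \<phi> assms(2)
    by (simp_all add: q_def conv_power_Suc_conv supported_conv supported_conv_power
        del: conv_power.simps)
  show "0 < overlap (conv_power G \<phi> k \<diamondop> p) (conv_power G \<phi> k \<diamondop> p)"
    by (rule overlap_self_pos)
  have "overlap (q (Suc k)) (q (Suc k)) = overlap (q k) (q (Suc (Suc k)))"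
    unfolding q_Suc by (rule overlap_self_adjoint[OF assms(1)]) (simp_all add: q supported_conv \<phi>)
  then show "(overlap (conv_power G \<phi> (Suc k) \<diamondop> p) (conv_power G \<phi> (Suc k) \<diamondop> p))\<^sup>2
      \<le> overlap (conv_power G \<phi> k \<diamondop> p) (conv_power G \<phi> k \<diamondop> p)
        * overlap (conv_power G \<phi> (Suc (Suc k)) \<diamondop> p) (conv_power G \<phi> (Suc (Suc k)) \<diamondop> p)"
    using overlap_Cauchy_Schwarz[of "q k" "q (Suc (Suc k))"] by (simp add: q_def)
qed

text \<open>
  Each probability mass function \<open>p\<close> bounds the return probability of \<open>\<phi>\<close> from below.  Since
  \<open>\<phi>\<^sup>2\<^sup>n\<close> is largest at the identity and \<open>p\<close> has mass 1, the return probability is at least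
  \<open>\<langle>p, \<phi>\<^sup>2\<^sup>n p\<rangle>\<close>.  Log-convexity of these moments then replaces the power of \<open>\<phi>\<close> by the power of
  the single quotient \<open>\<langle>p, \<phi> p\<rangle> / \<langle>p, p\<rangle>\<close>, as Jensen's inequality does for a spectral measure.
\<close>

theorem return_ge_test_distribution:
  assumes "symmetric_pmf_on G \<phi>" "supported p"
  shows "overlap p p * (overlap p (\<phi> \<diamondop> p) / overlap p p) ^ (2 * n)
    \<le> pmf (conv_power G \<phi> (2 * n)) \<one>"
proof -
  have \<phi>: "supported \<phi>"
    using assms by (simp add: symmetric_pmf_on_iff_reversed)
  let ?a = "\<lambda>k. overlap (conv_power G \<phi> k \<diamondop> p) (conv_power G \<phi> k \<diamondop> p)"
  interpret log_convex_sequence ?a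
    using assms by (rule log_convex_overlap_conv_power)
  have a0: "?a 0 = overlap p p" and a1: "?a 1 = overlap (\<phi> \<diamondop> p) (\<phi> \<diamondop> p)"
    using assms \<phi> by (simp_all add: conv_one_left conv_one_right)
  have "(overlap p (\<phi> \<diamondop> p) / overlap p p)\<^sup>2 \<le> ?a 1 / ?a 0"
    using overlap_Cauchy_Schwarz[of p "\<phi> \<diamondop> p"] overlap_self_pos[of p]
    unfolding a0 a1 by (simp add: divide_simps power2_eq_square mult.commute)
  then have "?a 0 * ((overlap p (\<phi> \<diamondop> p) / overlap p p)\<^sup>2) ^ n \<le> ?a 0 * (?a 1 / ?a 0) ^ n"
    by (intro mult_left_mono power_mono less_imp_le[OF pos]) auto
  also have "\<dots> \<le> ?a n"
    by (rule lower_geometric)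
  also have "?a n = overlap p (conv_power G \<phi> n \<diamondop> (conv_power G \<phi> n \<diamondop> p))"
    by (rule overlap_self_adjoint)
      (use assms \<phi> in \<open>simp_all add: symmetric_conv_power supported_conv supported_conv_power\<close>)
  also have "\<dots> = overlap p (conv_power G \<phi> (2 * n) \<diamondop> p)"
    using assms \<phi> by (simp add: mult_2 conv_power_add conv_assoc supported_conv_power)
  also have "\<dots> \<le> pmf (conv_power G \<phi> (2 * n)) \<one>"
    by (intro overlap_le pmf_conv_le pmf_even_conv_power_le assms supported_conv_power \<phi>)
  finally show ?thesis
    unfolding a0 power_mult .
qed

text \<open>
  Half of the squared \<open>\<ell>\<^sup>2\<close> distance between \<open>p\<close> and its translate by \<open>h\<close>.  Its mean under
  \<open>\<phi>\<close> is the Dirichlet form of \<open>\<phi>\<close> at \<open>p\<close>.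
\<close>

definition displacement :: "'a pmf \<Rightarrow> 'a \<Rightarrow> real" where
  "displacement p h = overlap p p - overlap p (map_pmf (\<lambda>x. h \<otimes> x) p)"

lemma displacement_le: "displacement p h \<le> overlap p p"
  using overlap_nonneg by (simp add: displacement_def)

lemma integral_displacement:
  "(\<integral>h. displacement p h \<partial>measure_pmf \<phi>) = overlap p p - overlap p (\<phi> \<diamondop> p)"
  and integrable_displacement: "integrable (measure_pmf \<phi>) (displacement p)"
proof -
  have int: "integrable (measure_pmf \<phi>) (\<lambda>h. overlap p (map_pmf (\<lambda>x. h \<otimes> x) p))"
    by (rule measure_pmf.integrable_const_bound[where B = 1]) (simp_all add: overlap_def)
  then show "integrable (measure_pmf \<phi>) (displacement p)"
    by (simp add: displacement_def[abs_def])
  show "(\<integral>h. displacement p h \<partial>measure_pmf \<phi>) = overlap p p - overlap p (\<phi> \<diamondop> p)"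
    using int by (simp add: displacement_def conv_pmf_eq_bind_left overlap_bind_pmf)
qed

lemma overlap_translate:
  assumes "h \<in> carrier G" "supported p" "supported q"
  shows "overlap (map_pmf (\<lambda>x. h \<otimes> x) p) (map_pmf (\<lambda>x. h \<otimes> x) q) = overlap p q"
  using assms by (intro overlap_map_inj) (auto simp: inj_on_def subset_iff)

lemma displacement_eq_sq_dist:
  assumes "h \<in> carrier G" "supported p"
  shows "2 * displacement p h = sq_dist p (map_pmf (\<lambda>x. h \<otimes> x) p)"
  using overlap_translate[OF assms(1,2,2)] by (simp add: displacement_def sq_dist_eq_overlap)

lemma displacement_nonneg:
  assumes "h \<in> carrier G" "supported p"
  shows "displacement p h \<ge> 0"
  using displacement_eq_sq_dist[OF assms] unfolding sq_dist_def
  by (smt (verit) Bochner_Integration.integral_nonneg zero_le_power2)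

lemma displacement_one: "supported p \<Longrightarrow> displacement p \<one> = 0"
  using map_pmf_cong[of p p "\<lambda>x. \<one> \<otimes> x" "\<lambda>x. x"] by (auto simp: displacement_def subset_iff)

lemma displacement_mult:
  assumes "g \<in> carrier G" "h \<in> carrier G" "supported p" "r > 0"
  shows "displacement p (g \<otimes> h) \<le> (1 + r) * displacement p g + (1 + 1 / r) * displacement p h"
proof -
  let ?T = "\<lambda>h. map_pmf (\<lambda>x. h \<otimes> x) p"
  have gh: "?T (g \<otimes> h) = map_pmf (\<lambda>x. g \<otimes> x) (?T h)"
    unfolding pmf.map_comp o_def
    using assms by (intro map_pmf_cong) (auto intro!: m_assoc)
  have "supported (?T h)"
    using assms by auto
  then have "sq_dist (?T g) (?T (g \<otimes> h)) = sq_dist p (?T h)"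
    unfolding gh sq_dist_eq_overlap using assms by (simp only: overlap_translate)
  then show ?thesis
    using sq_dist_triangle[OF assms(4), of p "?T (g \<otimes> h)" "?T g"] assms
    by (simp flip: displacement_eq_sq_dist add: algebra_simps)
qed

lemma foldr_mult_closed: "set ws \<subseteq> carrier G \<Longrightarrow> foldr (\<otimes>) ws \<one> \<in> carrier G"
  by (induction ws) auto

text \<open>
  Displacement grows at most quadratically in the word length: a translation is moved one letter
  at a time, and each letter costs at most \<open>D\<close>.
\<close>

lemma displacement_word:
  assumes "supported p" "S \<subseteq> carrier G" "\<And>s. s \<in> S \<Longrightarrow> displacement p s \<le> D"
    and "set ws \<subseteq> S"
  shows "displacement p (foldr (\<otimes>) ws \<one>) \<le> (real (length ws))\<^sup>2 * D"
  using assms(4)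
proof (induction ws)
  case Nil
  then show ?case
    by (simp add: displacement_one assms)
next
  case (Cons s ws)
  have s: "s \<in> S" "s \<in> carrier G"
    using Cons.prems assms by auto
  have w: "foldr (\<otimes>) ws \<one> \<in> carrier G"
    using Cons.prems assms by (intro foldr_mult_closed) auto
  show ?case
  proof (cases "ws = []")
    case True
    then show ?thesis
      using s assms by simp
  next
    case False
    define n where "n = real (length ws)"
    have n: "n > 0"
      using False by (simp add: n_def)
    have IH: "displacement p (foldr (\<otimes>) ws \<one>) \<le> n\<^sup>2 * D"
      using Cons by (simp add: n_def)
    have "displacement p (s \<otimes> foldr (\<otimes>) ws \<one>)
        \<le> (1 + n) * displacement p s + (1 + 1 / n) * displacement p (foldr (\<otimes>) ws \<one>)"
      using s w assms n by (intro displacement_mult)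
    also have "\<dots> \<le> (1 + n) * D + (1 + 1 / n) * (n\<^sup>2 * D)"
      using assms(3)[OF s(1)] IH n by (intro add_mono mult_left_mono) auto
    also have "\<dots> = (n + 1)\<^sup>2 * D"
      using n by (simp add: field_simps power2_eq_square)
    finally show ?thesis
      by (simp add: n_def add.commute)
  qed
qed

end

section \<open>Groups with a finite symmetric generating set\<close>

locale symmetric_generating_set = group G
  for G :: "('a, 'b) monoid_scheme" (structure) +
  fixes S :: "'a set"
  assumes finite_S: "finite S"
    and S_subset: "S \<subseteq> carrier G"
    and one_in_S: "\<one> \<in> S"
    and S_inv: "s \<in> S \<Longrightarrow> inv s \<in> S"
    and generate_S: "generate G S = carrier G"
begin

abbreviation simple_walk :: "nat \<Rightarrow> 'a pmf" where
  "simple_walk \<equiv> conv_power G (pmf_of_set S)"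

lemma foldr_append_mult:
  "set ws \<subseteq> carrier G \<Longrightarrow> set vs \<subseteq> carrier G \<Longrightarrow>
    foldr (\<otimes>) (ws @ vs) \<one> = foldr (\<otimes>) ws \<one> \<otimes> foldr (\<otimes>) vs \<one>"
  by (induction ws) (auto simp: m_assoc foldr_mult_closed)

lemma ex_word:
  assumes "g \<in> carrier G"
  obtains ws where "set ws \<subseteq> S" "length ws = word_length G S g" "foldr (\<otimes>) ws \<one> = g"
proof -
  have "\<exists>ws. set ws \<subseteq> S \<and> foldr (\<otimes>) ws \<one> = g" if "g \<in> generate G S" for g
    using that
  proof induction
    case one
    show ?case
      by (intro exI[of _ "[]"]) simp
  next
    case (incl h)
    then show ?case
      using S_subset by (intro exI[of _ "[h]"]) auto
  next
    case (inv h)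
    then show ?case
      using S_inv S_subset by (intro exI[of _ "[inv h]"]) auto
  next
    case (eng h1 h2)
    then obtain ws vs where "set ws \<subseteq> S" "foldr (\<otimes>) ws \<one> = h1"
      "set vs \<subseteq> S" "foldr (\<otimes>) vs \<one> = h2"
      by blast
    then show ?case
      using S_subset by (intro exI[of _ "ws @ vs"]) (auto simp: foldr_append_mult simp del: foldr_append)
  qed
  then obtain ws where "set ws \<subseteq> S" "foldr (\<otimes>) ws \<one> = g"
    using assms generate_S by auto
  then have "\<exists>n ws. length ws = n \<and> set ws \<subseteq> S \<and> foldr (\<otimes>) ws \<one> = g"
    by blast
  from LeastI_ex[OF this] show ?thesis
    using that unfolding word_length_def by blast
qed

lemma word_length_foldr_le:
  assumes "set ws \<subseteq> S"
  shows "word_length G S (foldr (\<otimes>) ws \<one>) \<le> length ws"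
  unfolding word_length_def using assms by (intro Least_le) blast

lemma symmetric_pmf_of_set: "symmetric_pmf_on G (pmf_of_set S)"
proof -
  have "inv g \<in> S \<longleftrightarrow> g \<in> S" if "g \<in> carrier G" for g
    using S_inv[of g] S_inv[of "inv g"] that by auto
  moreover have "S \<noteq> {}"
    using one_in_S by auto
  ultimately show ?thesis
    using finite_S S_subset by (simp add: symmetric_pmf_on_def indicator_def)
qed

lemma set_pmf_of_S: "set_pmf (pmf_of_set S) = S"
  using finite_S one_in_S by (intro set_pmf_of_set) auto

lemma supported_simple_walk: "supported (simple_walk n)"
  by (intro supported_conv_power) (simp add: set_pmf_of_S S_subset)

lemma word_length_simple_walk:
  assumes "g \<in> set_pmf (simple_walk n)"
  shows "word_length G S g \<le> n"
proof -
  have "\<exists>ws. set ws \<subseteq> S \<and> length ws = n \<and> foldr (\<otimes>) ws \<one> = g"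
    using assms
  proof (induction n arbitrary: g)
    case (Suc n)
    then obtain s h where "s \<in> S" "h \<in> set_pmf (simple_walk n)" "g = s \<otimes> h"
      by (auto simp: set_conv_pmf set_pmf_of_S)
    moreover from this(2) obtain ws where "set ws \<subseteq> S" "length ws = n" "foldr (\<otimes>) ws \<one> = h"
      using Suc.IH by blast
    ultimately show ?case
      by (intro exI[of _ "s # ws"]) auto
  qed simp
  then show ?thesis
    using word_length_foldr_le by blast
qed

lemma return_prob_even: "return_prob G S (2 * n) = overlap (simple_walk n) (simple_walk n)"
  unfolding return_prob_def by (rule return_even_eq_overlap[OF symmetric_pmf_of_set])

lemma log_convex_return_prob: "log_convex_sequence (\<lambda>n. return_prob G S (2 * n))"
  using log_convex_overlap_conv_power[OF symmetric_pmf_of_set, of "return_pmf \<one>"]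
  by (simp add: conv_one_right supported_simple_walk return_prob_even)

text \<open>
  The drop of the return probability over two steps is the mean displacement under two steps of
  the simple walk, and every generator is reached in two steps with probability at least
  \<open>1 / |S|\<^sup>2\<close> because the walk may rest for one of them.
\<close>

lemma displacement_generator_le:
  assumes "s \<in> S"
  shows "displacement (simple_walk m) s
    \<le> (real (card S))\<^sup>2 * (return_prob G S (2 * m) - return_prob G S (2 * Suc m))"
proof -
  let ?u = "pmf_of_set S" and ?p = "simple_walk m"
  have u: "supported ?u" and p: "supported ?p"
    by (simp_all add: set_pmf_of_S S_subset supported_simple_walk)
  have s: "s \<in> carrier G"
    using assms S_subset by auto
  have card: "card S > 0"
    using finite_S assms by (auto simp: card_gt_0_iff)
  have "return_prob G S (2 * Suc m) = overlap (?u \<diamondop> ?p) (?u \<diamondop> ?p)"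
    unfolding return_prob_even by simp
  also have "\<dots> = overlap ?p ((?u \<diamondop> ?u) \<diamondop> ?p)"
    using overlap_self_adjoint[OF symmetric_pmf_of_set p supported_conv[OF u p]] u p
    by (simp add: conv_assoc)
  finally have diff: "return_prob G S (2 * m) - return_prob G S (2 * Suc m)
      = (\<integral>h. displacement ?p h \<partial>measure_pmf (?u \<diamondop> ?u))"
    by (simp add: integral_displacement return_prob_even)
  have "1 / (real (card S))\<^sup>2 = pmf (pair_pmf ?u ?u) (\<one>, s)"
    using finite_S one_in_S assms
    by (subst pmf_pair, subst (1 2) pmf_of_set) (auto simp: power2_eq_square)
  also have "\<dots> \<le> measure_pmf.prob (pair_pmf ?u ?u) ((\<lambda>(x, y). x \<otimes> y) -` {s})"
    unfolding measure_pmf_single[symmetric]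
    using s by (intro measure_pmf.finite_measure_mono) auto
  also have "\<dots> = pmf (?u \<diamondop> ?u) s"
    by (simp add: conv_pmf_def pmf_map)
  finally have mass: "1 / (real (card S))\<^sup>2 \<le> pmf (?u \<diamondop> ?u) s" .
  have "displacement ?p s * (1 / (real (card S))\<^sup>2) \<le> displacement ?p s * pmf (?u \<diamondop> ?u) s"
    by (intro mult_left_mono mass displacement_nonneg s p)
  also have "\<dots> = (\<integral>h. displacement ?p s * indicator {s} h \<partial>measure_pmf (?u \<diamondop> ?u))"
    by (simp add: measure_pmf_single)
  also have "\<dots> \<le> (\<integral>h. displacement ?p h \<partial>measure_pmf (?u \<diamondop> ?u))"
  proof (rule integral_mono_AE)
    show "AE h in measure_pmf (?u \<diamondop> ?u). displacement ?p s * indicator {s} h \<le> displacement ?p h"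
      using displacement_nonneg[OF _ p] supported_conv[OF u u]
      by (auto simp: AE_measure_pmf_iff indicator_def)
  qed (simp_all add: integrable_displacement integrable_indicator_pmf)
  finally show ?thesis
    unfolding diff using card by (simp add: field_simps)
qed

text \<open>
  The test distribution is the law of the simple walk at time \<open>m\<close>.  Steps of \<open>\<phi>\<close> of length at most
  \<open>r\<close> displace it by at most \<open>r\<^sup>2\<close> times the displacement of a generator.  A longer step may destroy
  the overlap completely, but no more than that, so only its probability counts.
\<close>

theorem return_ge_truncation:
  fixes m n :: nat and r :: real and \<phi> :: "'a pmf"
  defines "x \<equiv> r\<^sup>2 * (real (card S))\<^sup>2 * (1 - return_prob G S (2 * Suc m) / return_prob G S (2 * m))
    + measure_pmf.prob \<phi> {g \<in> carrier G. real (word_length G S g) > r}"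
  assumes "symmetric_pmf_on G \<phi>" "r \<ge> 0" "x \<le> 1"
  shows "return_prob G S (2 * m) * (1 - x) ^ (2 * n) \<le> pmf (conv_power G \<phi> (2 * n)) \<one>"
proof -
  let ?p = "simple_walk m"
  let ?A = "{g \<in> carrier G. real (word_length G S g) > r}"
  define D where "D = (real (card S))\<^sup>2 * (return_prob G S (2 * m) - return_prob G S (2 * Suc m))"
  define a where "a = return_prob G S (2 * m)"
  have a: "a = overlap ?p ?p" "a > 0"
    by (simp_all add: a_def return_prob_even overlap_self_pos)
  have p: "supported ?p" and \<phi>: "supported \<phi>"
    using assms(2) by (simp_all add: supported_simple_walk symmetric_pmf_on_iff_reversed)
  have D: "D \<ge> 0"
    using displacement_generator_le[OF one_in_S, of m] displacement_one[OF p] by (simp add: D_def)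
  have le: "displacement ?p h \<le> r\<^sup>2 * D + a * indicator ?A h" if h: "h \<in> carrier G" for h
  proof (cases "real (word_length G S h) > r")
    case True
    then show ?thesis
      using displacement_le[of ?p h] a D h by (simp add: add_increasing)
  next
    case False
    obtain ws where ws: "set ws \<subseteq> S" "length ws = word_length G S h" "foldr (\<otimes>) ws \<one> = h"
      using ex_word[OF h] .
    have "displacement ?p h \<le> (real (length ws))\<^sup>2 * D"
      using displacement_word[OF p S_subset _ ws(1), of D] ws displacement_generator_le
      by (simp add: D_def)
    also have "\<dots> \<le> r\<^sup>2 * D"
      using False ws D by (intro mult_right_mono power_mono) auto
    finally show ?thesis
      using False by simp
  qed
  have "a - overlap ?p (\<phi> \<diamondop> ?p) = (\<integral>h. displacement ?p h \<partial>measure_pmf \<phi>)"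
    by (simp add: integral_displacement a)
  also have "\<dots> \<le> (\<integral>h. r\<^sup>2 * D + a * indicator ?A h \<partial>measure_pmf \<phi>)"
  proof (rule integral_mono_AE)
    show "AE h in measure_pmf \<phi>. displacement ?p h \<le> r\<^sup>2 * D + a * indicator ?A h"
      using le \<phi> by (auto simp: AE_measure_pmf_iff)
    show "integrable (measure_pmf \<phi>) (\<lambda>h. r\<^sup>2 * D + a * indicator ?A h)"
      by (simp add: integrable_indicator_pmf)
  qed (rule integrable_displacement)
  also have "\<dots> = r\<^sup>2 * D + a * measure_pmf.prob \<phi> ?A"
    by (subst Bochner_Integration.integral_add) (simp_all add: integrable_indicator_pmf)
  also have "\<dots> = a * x"
    unfolding x_def D_def a_def[symmetric] using a(2) by (simp add: field_simps)
  finally have "1 - x \<le> overlap ?p (\<phi> \<diamondop> ?p) / a"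
    using a(2) by (simp add: field_simps)
  then have "a * (1 - x) ^ (2 * n) \<le> a * (overlap ?p (\<phi> \<diamondop> ?p) / a) ^ (2 * n)"
    using a(2) \<open>x \<le> 1\<close> by (intro mult_left_mono power_mono) auto
  also have "\<dots> \<le> pmf (conv_power G \<phi> (2 * n)) \<one>"
    unfolding a(1) by (rule return_ge_test_distribution[OF assms(2) p])
  finally show ?thesis
    by (simp add: a_def)
qed

end

section \<open>Mixtures of the powers of the simple walk\<close>

text \<open>
  The mass at \<open>j\<close> is the decrement \<open>F j - F (j + 1)\<close>; these telescope to \<open>F 0\<close> because
  \<open>F\<close> tends to 0.
\<close>

lemma ex_nat_pmf_with_tail:
  fixes F :: "nat \<Rightarrow> real"
  assumes "F 0 = 1" "decseq F" "F \<longlonglongrightarrow> 0"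
  obtains N :: "nat pmf" where "\<And>r. measure_pmf.prob N {r..} = F r"
proof -
  let ?f = "\<lambda>j. F j - F (Suc j)"
  have nonneg: "?f j \<ge> 0" for j
    using assms(2) by (simp add: decseq_Suc_iff)
  have "?f sums 1"
    using telescope_sums'[OF assms(3)] assms(1) by simp
  with nonneg have "(\<Sum>j. ennreal (?f j)) = ennreal 1"
    by (rule suminf_ennreal_eq)
  then have total: "(\<integral>\<^sup>+ j. ennreal (?f j) \<partial>count_space UNIV) = 1"
    unfolding nn_integral_count_space_nat ennreal_1 .
  define N where "N = embed_pmf ?f"
  have N: "pmf N j = ?f j" for j
    unfolding N_def by (rule pmf_embed_pmf[OF nonneg total])
  have "measure_pmf.prob N {r..} = F r" for r
  proof -
    have "{r..} = UNIV - {..<r}"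
      by auto
    then have "measure_pmf.prob N {r..} = 1 - measure_pmf.prob N {..<r}"
      using measure_pmf.prob_compl[of "{..<r}" N] by simp
    also have "measure_pmf.prob N {..<r} = (\<Sum>j<r. ?f j)"
      by (simp add: measure_measure_pmf_finite N)
    also have "\<dots> = 1 - F r"
      using sum_lessThan_telescope'[of F r] assms(1) by simp
    finally show ?thesis
      by simp
  qed
  then show ?thesis
    using that by blast
qed

text \<open>
  Sums of independent natural numbers are convolution powers on this monoid, which makes the law of
  the total time of a mixed walk available without a separate definition.
\<close>

abbreviation nat_add :: "nat monoid" where
  "nat_add \<equiv> \<lparr>carrier = UNIV, mult = (+), one = 0\<rparr>"

text \<open>
  A sum of natural numbers stays below \<open>r\<close> only if each summand does.
\<close>

lemma prob_sum_less:
  fixes N :: "nat pmf"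
  shows "measure_pmf.prob (conv_power nat_add N k) {..<r} \<le> measure_pmf.prob N {..<r} ^ k"
proof (induction k)
  case (Suc k)
  let ?M = "conv_power nat_add N k"
  have "measure_pmf.prob (conv_power nat_add N (Suc k)) {..<r}
      = measure_pmf.prob (pair_pmf N ?M) ((\<lambda>(x, y). x + y) -` {..<r})"
    by (simp add: conv_pmf_def)
  also have "\<dots> \<le> measure_pmf.prob (pair_pmf N ?M) ({..<r} \<times> {..<r})"
    by (intro measure_pmf.finite_measure_mono) auto
  also have "\<dots> = measure_pmf.prob N {..<r} * measure_pmf.prob ?M {..<r}"
    by (simp add: measure_pmf_prob_product)
  also have "\<dots> \<le> measure_pmf.prob N {..<r} * measure_pmf.prob N {..<r} ^ k"
    by (intro mult_left_mono Suc.IH) simp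
  finally show ?case
    by simp
qed (simp add: measure_return_pmf)

lemma conv_pmf_bind:
  "conv_pmf G (bind_pmf M f) (bind_pmf M' f') =
    bind_pmf M (\<lambda>i. bind_pmf M' (\<lambda>j. conv_pmf G (f i) (f' j)))"
proof -
  have "conv_pmf G (bind_pmf M f) (bind_pmf M' f') =
      bind_pmf M (\<lambda>i. bind_pmf (f i) (\<lambda>x. bind_pmf M' (\<lambda>j. map_pmf (\<lambda>y. x \<otimes>\<^bsub>G\<^esub> y) (f' j))))"
    by (simp add: conv_pmf_eq_bind_left bind_assoc_pmf map_bind_pmf)
  also have "\<dots> = bind_pmf M (\<lambda>i. bind_pmf M' (\<lambda>j. conv_pmf G (f i) (f' j)))"
    unfolding conv_pmf_eq_bind_left by (intro bind_pmf_cong refl bind_commute_pmf)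
  finally show ?thesis .
qed

context group
begin

text \<open>
  A step of the mixture consists of a random number of steps of \<open>\<mu>\<close>; after \<open>k\<close> of them the total
  number of \<open>\<mu>\<close>-steps is the sum of \<open>k\<close> independent copies of \<open>N\<close>.
\<close>

lemma conv_power_mixture:
  assumes "supported \<mu>"
  shows "conv_power G (bind_pmf N (conv_power G \<mu>)) k
    = bind_pmf (conv_power nat_add N k) (conv_power G \<mu>)"
proof (induction k)
  case (Suc k)
  let ?M = "conv_power nat_add N k"
  have "conv_power G (bind_pmf N (conv_power G \<mu>)) (Suc k)
      = bind_pmf N (\<lambda>i. bind_pmf ?M (\<lambda>j. conv_power G \<mu> i \<diamondop> conv_power G \<mu> j))"
    by (simp add: Suc.IH conv_pmf_bind)
  also have "\<dots> = bind_pmf (conv_power nat_add N (Suc k)) (conv_power G \<mu>)"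
    by (simp add: conv_power_add[OF assms] conv_pmf_eq_bind_left bind_assoc_pmf bind_map_pmf)
  finally show ?case .
qed (simp add: bind_return_pmf)

text \<open>
  Either the total time stays below \<open>r\<close>, or the walk has taken at least \<open>r\<close> steps of \<open>\<mu>\<close>.
\<close>

theorem return_mixture_le:
  assumes "supported \<mu>" and "\<And>j. j \<ge> r \<Longrightarrow> pmf (conv_power G \<mu> j) \<one> \<le> \<epsilon>"
  shows "pmf (conv_power G (bind_pmf N (conv_power G \<mu>)) k) \<one>
    \<le> measure_pmf.prob N {..<r} ^ k + \<epsilon>"
proof -
  let ?M = "conv_power nat_add N k"
  have "0 \<le> \<epsilon>"
    by (rule order_trans[OF pmf_nonneg assms(2)[OF order_refl]])
  have "pmf (conv_power G (bind_pmf N (conv_power G \<mu>)) k) \<one>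
      = (\<integral>j. pmf (conv_power G \<mu> j) \<one> \<partial>measure_pmf ?M)"
    by (simp add: conv_power_mixture[OF assms(1)] pmf_bind)
  also have "\<dots> \<le> (\<integral>j. indicator {..<r} j + \<epsilon> \<partial>measure_pmf ?M)"
  proof (rule integral_mono)
    show "integrable (measure_pmf ?M) (\<lambda>j. pmf (conv_power G \<mu> j) \<one>)"
      by (rule measure_pmf.integrable_const_bound[where B = 1]) (simp_all add: pmf_le_1)
    show "pmf (conv_power G \<mu> j) \<one> \<le> indicator {..<r} j + \<epsilon>" for j
      using assms(2)[of j] pmf_le_1[of "conv_power G \<mu> j" \<one>] \<open>0 \<le> \<epsilon>\<close>
      by (cases "j < r") (simp_all add: add_increasing2)
  qed (simp add: integrable_indicator_pmf)
  also have "\<dots> = measure_pmf.prob ?M {..<r} + \<epsilon>"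
    by (subst Bochner_Integration.integral_add) (simp_all add: integrable_indicator_pmf)
  also have "\<dots> \<le> measure_pmf.prob N {..<r} ^ k + \<epsilon>"
    using prob_sum_less by simp
  finally show ?thesis .
qed

lemma symmetric_mixture:
  assumes "symmetric_pmf_on G \<mu>"
  shows "symmetric_pmf_on G (bind_pmf N (conv_power G \<mu>))"
proof -
  have "supported \<mu>"
    using assms by (simp add: symmetric_pmf_on_iff_reversed)
  then have "supported (bind_pmf N (conv_power G \<mu>))"
    using supported_conv_power[of \<mu>] by (simp add: UN_subset_iff)
  then show ?thesis
    using reversed_conv_power[OF assms] by (simp add: symmetric_pmf_on_iff_reversed map_bind_pmf)
qed

end

text \<open>
  After \<open>j\<close> steps the simple walk has length at most \<open>j\<close>, so the tail of \<open>\<rho>\<close> of the length is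
  dominated by the tail of \<open>\<rho> N\<close>.
\<close>

lemma (in symmetric_generating_set) weak_moment_mixture_le:
  fixes \<rho> :: "real \<Rightarrow> real"
  assumes \<rho>: "\<And>t. t \<ge> 0 \<Longrightarrow> \<rho> t \<ge> 1" "mono_on {0..} \<rho>" "filterlim \<rho> at_top at_top"
    and N: "\<And>r. r > 0 \<Longrightarrow> measure_pmf.prob N {r..} \<le> 1 / \<rho> (real r)"
  shows "weak_moment G S \<rho> (bind_pmf N simple_walk) \<le> ereal (\<rho> 0)"
  unfolding weak_moment_def
proof (rule SUP_least)
  fix s :: real
  assume "s \<in> {0<..}"
  then have s: "s > 0"
    by simp
  let ?A = "{g \<in> carrier G. \<rho> (real (word_length G S g)) > s}"
  have "\<forall>\<^sub>F t in at_top. s < \<rho> t"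
    using \<rho>(3) by (simp add: filterlim_at_top_dense)
  then have "\<forall>\<^sub>F j in sequentially. s < \<rho> (real j)"
    using filterlim_real_sequentially by (rule eventually_compose_filterlim)
  then have ex: "\<exists>j. s < \<rho> (real j)"
    by (auto simp: eventually_sequentially)
  \<comment> \<open>The first time at which \<open>\<rho>\<close> exceeds \<open>s\<close>: then \<open>s\<close> is below \<open>\<rho> r\<close>, which cancels the tail of \<open>N\<close>.\<close>
  define r where "r = (LEAST j. s < \<rho> (real j))"
  have r: "s < \<rho> (real r)"
    unfolding r_def using ex by (rule LeastI_ex)
  have mono: "\<rho> (real i) \<le> \<rho> (real j)" if "i \<le> j" for i j
    using that by (intro mono_onD[OF \<rho>(2)]) auto
  have "emeasure (measure_pmf (bind_pmf N simple_walk)) ?A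
      = (\<integral>\<^sup>+ j. emeasure (measure_pmf (simple_walk j)) ?A \<partial>measure_pmf N)"
    by (rule emeasure_bind_pmf)
  also have "\<dots> \<le> (\<integral>\<^sup>+ j. indicator {r..} j \<partial>measure_pmf N)"
  proof (rule nn_integral_mono)
    fix j
    show "emeasure (measure_pmf (simple_walk j)) ?A \<le> indicator {r..} j"
    proof (cases "r \<le> j")
      case True
      then show ?thesis
        by (simp add: measure_pmf.emeasure_le_1)
    next
      case False
      then have "\<rho> (real j) \<le> s"
        unfolding r_def using not_less_Least by (metis linorder_le_less_linear not_less)
      then have "set_pmf (simple_walk j) \<inter> ?A = {}"
        using mono[OF word_length_simple_walk] by fastforce
      then have "emeasure (measure_pmf (simple_walk j)) ?A = 0"
        by (simp add: measure_pmf.emeasure_eq_measure measure_pmf_zero_iff)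
      then show ?thesis
        by simp
    qed
  qed
  also have "\<dots> = measure_pmf.prob N {r..}"
    by (simp add: measure_pmf.emeasure_eq_measure)
  finally have le: "measure_pmf.prob (bind_pmf N simple_walk) ?A \<le> measure_pmf.prob N {r..}"
    by (simp add: measure_pmf.emeasure_eq_measure)
  have "s * measure_pmf.prob (bind_pmf N simple_walk) ?A \<le> \<rho> 0"
  proof (cases "r = 0")
    case True
    have "s * measure_pmf.prob (bind_pmf N simple_walk) ?A \<le> s"
      using s by (simp add: mult_left_le)
    then show ?thesis
      using r True by simp
  next
    case False
    have "s * measure_pmf.prob (bind_pmf N simple_walk) ?A \<le> \<rho> (real r) * (1 / \<rho> (real r))"
      using False s r le N[of r] by (intro mult_mono) auto
    also have "\<dots> = 1"
      using r s by simp
    also have "\<dots> \<le> \<rho> 0"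
      by (simp add: \<rho>(1))
    finally show ?thesis .
  qed
  then show "ereal (s * measure_pmf.prob (bind_pmf N simple_walk) ?A) \<le> ereal (\<rho> 0)"
    by simp
qed

section \<open>Slowly varying gauges\<close>

lemma tail_integral_pos:
  fixes f :: "real \<Rightarrow> real"
  assumes "set_integrable lborel {0..} f" "\<And>s. s \<ge> 0 \<Longrightarrow> f s > 0" "t \<ge> 0"
  shows "(LBINT s:{t..}. f s) > 0"
proof -
  have int: "set_integrable lborel {t..} f"
    using assms by (intro set_integrable_subset[OF assms(1)]) auto
  have nonneg: "AE s in lborel. 0 \<le> indicator {t..} s *\<^sub>R f s"
    using assms by (intro AE_I2) (auto simp: indicator_def less_imp_le)
  have "(LBINT s:{t..}. f s) \<noteq> 0"
  proof
    assume "(LBINT s:{t..}. f s) = 0"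
    then have "AE s in lborel. indicator {t..} s *\<^sub>R f s = 0"
      using integral_nonneg_eq_0_iff_AE[OF _ nonneg] int
      unfolding set_lebesgue_integral_def set_integrable_def by blast
    then have "AE s in lborel. s \<notin> {t..t + 1}"
    proof eventually_elim
      case (elim s)
      then show ?case
        using assms(2)[of s] assms(3) by (auto simp: indicator_def)
    qed
    then have "emeasure lborel {t..t + 1} = 0"
      by (subst (asm) AE_iff_measurable[where N = "{t..t + 1}"]) auto
    then show False
      by simp
  qed
  moreover have "(LBINT s:{t..}. f s) \<ge> 0"
    unfolding set_lebesgue_integral_def using nonneg by (rule integral_nonneg_AE)
  ultimately show ?thesis
    by simp
qed

lemma tail_integral_tendsto_0:
  fixes f :: "real \<Rightarrow> real"
  assumes "set_integrable lborel {0..} f"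
  shows "((\<lambda>t. LBINT s:{t..}. f s) \<longlongrightarrow> 0) at_top"
proof -
  let ?g = "\<lambda>s. indicator {0..} s *\<^sub>R f s"
  have g: "integrable lborel ?g"
    using assms by (simp add: set_integrable_def)
  have "((\<lambda>t. LINT s|lborel. indicator {t..} s *\<^sub>R ?g s) \<longlongrightarrow> (LINT s|(lborel :: real measure). (0::real))) at_top"
  proof (rule integral_dominated_convergence_at_top[where w = "\<lambda>s. norm (?g s)"
        and s = "\<lambda>t s. indicator {t..} s *\<^sub>R ?g s"])
    show "integrable lborel (\<lambda>s. norm (?g s))"
      using g by (rule integrable_norm)
    show "AE s in lborel. ((\<lambda>t. indicator {t..} s *\<^sub>R ?g s) \<longlongrightarrow> 0) at_top"
    proof (rule AE_I2, rule tendsto_eventually)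
      show "\<forall>\<^sub>F t in at_top. indicator {t..} s *\<^sub>R ?g s = 0" for s
        using eventually_gt_at_top[of s] by eventually_elim simp
    qed
    show "\<forall>\<^sub>F t in at_top. AE s in lborel. norm (indicator {t..} s *\<^sub>R ?g s) \<le> norm (?g s)"
      by (auto simp: indicator_def)
    show "(\<lambda>s. indicator {t..} s *\<^sub>R ?g s) \<in> borel_measurable lborel" for t :: real
      by (rule borel_measurable_scaleR[OF borel_measurable_indicator borel_measurable_integrable[OF g]])
        simp
  qed auto
  moreover have "\<forall>\<^sub>F t in at_top. (LINT s|lborel. indicator {t..} s *\<^sub>R ?g s) = (LBINT s:{t..}. f s)"
    using eventually_ge_at_top[of "0::real"]
  proof eventually_elim
    case (elim t)
    then have "(\<lambda>s. indicator {t..} s *\<^sub>R ?g s) = (\<lambda>s. indicator {t..} s *\<^sub>R f s)"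
      by (auto simp: indicator_def fun_eq_iff)
    then show ?case
      by (simp add: set_lebesgue_integral_def)
  qed
  ultimately show ?thesis
    by (simp add: tendsto_cong)
qed

text \<open>
  Used to pass from the reciprocal of the tail integral to \<open>\<rho>\<close> itself.
\<close>

lemma at_top_of_lesssim:
  fixes f g :: "real \<Rightarrow> real"
  assumes "f \<lesssim> g" "filterlim f at_top at_top"
  shows "filterlim g at_top at_top"
proof -
  obtain c1 c2 where c: "c1 > 0" "c2 > 0" and le: "\<forall>\<^sub>F t in at_top. f t \<le> c1 * g (c2 * t)"
    using assms(1) by (auto simp: lesssim_def)
  have "filterlim (\<lambda>t. c1 * g (c2 * t)) at_top at_top"
    by (rule filterlim_at_top_mono[OF assms(2) le])
  moreover have "filterlim (\<lambda>s. s / c2) at_top at_top"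
    using c by real_asymp
  ultimately have "filterlim (\<lambda>s. c1 * g (c2 * (s / c2))) at_top at_top"
    by (rule filterlim_compose)
  then have "filterlim (\<lambda>s. c1 * g s) at_top at_top"
    using c by simp
  then show ?thesis
    by (subst (asm) filterlim_tendsto_pos_mult_at_top_iff[OF tendsto_const c(1)])
qed

lemma eventually_nat_floor:
  assumes "eventually P sequentially"
  shows "\<forall>\<^sub>F t in at_top. P (nat \<lfloor>t\<rfloor>)"
  using assms filterlim_compose[OF filterlim_nat_sequentially filterlim_floor_sequentially]
  by (rule eventually_compose_filterlim)

lemma eventually_real_sequentially:
  fixes P :: "real \<Rightarrow> bool"
  assumes "eventually P at_top"
  shows "\<forall>\<^sub>F n in sequentially. P (real n)"
  using assms filterlim_real_sequentially by (rule eventually_compose_filterlim)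

text \<open>
  Everything that the two bounds require of the gauge: being unbounded, and insensitive up to
  constants to replacing \<open>t\<close> by a multiple or a power of \<open>t\<close>.
\<close>

locale slow_gauge =
  fixes \<rho> :: "real \<Rightarrow> real"
  assumes ge_one: "t \<ge> 0 \<Longrightarrow> \<rho> t \<ge> 1"
    and mono: "mono_on {0..} \<rho>"
    and at_top: "filterlim \<rho> at_top at_top"
    and slow: "slowly_varying \<rho>"
    and powers: "a > 0 \<Longrightarrow> (\<lambda>t. \<rho> (t powr a)) \<lesssim> \<rho>"
begin

lemma pos: "t \<ge> 0 \<Longrightarrow> \<rho> t > 0"
  using ge_one[of t] by simp

lemma le: "0 \<le> s \<Longrightarrow> s \<le> t \<Longrightarrow> \<rho> s \<le> \<rho> t"
  using mono by (auto simp: mono_on_def)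

lemma scaling_le:
  assumes "c > 0" "K > 1"
  shows "\<forall>\<^sub>F t in at_top. \<rho> (c * t) \<le> K * \<rho> t"
proof -
  have "((\<lambda>t. \<rho> (c * t) / \<rho> t) \<longlongrightarrow> 1) at_top"
    using slow assms by (auto simp: slowly_varying_def regularly_varying_def)
  then have "\<forall>\<^sub>F t in at_top. \<rho> (c * t) / \<rho> t < K"
    using assms by (simp add: order_tendstoD)
  then show ?thesis
    using eventually_ge_at_top[of 0]
    by eventually_elim (use pos in \<open>fastforce simp: divide_simps mult.commute\<close>)
qed

lemma scaling_ge:
  assumes "c > 0" "K > 1"
  shows "\<forall>\<^sub>F t in at_top. \<rho> t \<le> K * \<rho> (c * t)"
proof -
  have "\<forall>\<^sub>F s in at_top. \<rho> (inverse c * s) \<le> K * \<rho> s"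
    using assms by (intro scaling_le) auto
  moreover have "filterlim (\<lambda>t. c * t) at_top at_top"
    using assms by real_asymp
  ultimately have "\<forall>\<^sub>F t in at_top. \<rho> (inverse c * (c * t)) \<le> K * \<rho> (c * t)"
    by (rule eventually_compose_filterlim)
  then show ?thesis
    using assms by (simp add: mult.assoc[symmetric])
qed

lemma power_le:
  assumes "a > 0"
  obtains C where "C > 0" "\<forall>\<^sub>F t in at_top. \<rho> (t powr a) \<le> C * \<rho> t"
proof -
  obtain c1 c2 where c: "c1 > 0" "c2 > 0"
    and le: "\<forall>\<^sub>F t in at_top. \<rho> (t powr a) \<le> c1 * \<rho> (c2 * t)"
    using powers[OF assms] by (auto simp: lesssim_def)
  have "\<forall>\<^sub>F t in at_top. \<rho> (t powr a) \<le> (c1 * 2) * \<rho> t"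
    using le scaling_le[OF c(2), of 2, simplified]
  proof eventually_elim
    case (elim t)
    have "c1 * \<rho> (c2 * t) \<le> c1 * (2 * \<rho> t)"
      using elim c by (intro mult_left_mono) auto
    then show ?case
      using elim by simp
  qed
  then show ?thesis
    using that[of "c1 * 2"] c by simp
qed

text \<open>
  The upper bound for the exponent \<open>1 / a\<close>, read at the point \<open>t powr a\<close>.
\<close>

lemma power_ge:
  assumes "a > 0"
  obtains C where "C > 0" "\<forall>\<^sub>F t in at_top. \<rho> t \<le> C * \<rho> (t powr a)"
proof -
  obtain C where C: "C > 0" "\<forall>\<^sub>F s in at_top. \<rho> (s powr (1 / a)) \<le> C * \<rho> s"
    using power_le[of "1 / a"] assms by auto
  have "filterlim (\<lambda>t::real. t powr a) at_top at_top"
    using assms by real_asymp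
  with C(2) have "\<forall>\<^sub>F t in at_top. \<rho> ((t powr a) powr (1 / a)) \<le> C * \<rho> (t powr a)"
    by (rule eventually_compose_filterlim)
  then have "\<forall>\<^sub>F t in at_top. \<rho> t \<le> C * \<rho> (t powr a)"
    using eventually_gt_at_top[of 0]
    by eventually_elim (use assms in \<open>simp add: powr_powr\<close>)
  with C(1) show ?thesis
    by (rule that)
qed

text \<open>
  Doubling the argument multiplies \<open>\<rho>\<close> by at most \<open>2 powr \<delta>\<close> from some point \<open>T\<close> on; iterating this
  over the dyadic intervals above \<open>T\<close> gives growth of order at most \<open>\<delta>\<close>.
\<close>

lemma sublinear:
  assumes "\<delta> > 0"
  obtains C where "C > 0" "\<forall>\<^sub>F t in at_top. \<rho> t \<le> C * t powr \<delta>"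
proof -
  have "2 powr \<delta> > 1"
    using assms by simp
  then have "\<forall>\<^sub>F t in at_top. \<rho> (2 * t) \<le> 2 powr \<delta> * \<rho> t"
    by (intro scaling_le) auto
  then obtain T0 where T0: "\<And>t. t \<ge> T0 \<Longrightarrow> \<rho> (2 * t) \<le> 2 powr \<delta> * \<rho> t"
    unfolding eventually_at_top_linorder by blast
  define T where "T = max 1 T0"
  have T: "T > 0" "\<And>t. t \<ge> T \<Longrightarrow> \<rho> (2 * t) \<le> 2 powr \<delta> * \<rho> t"
    using T0 by (simp_all add: T_def)
  have "\<rho> t \<le> \<rho> (2 * T) * (t / T) powr \<delta>" if "T \<le> t" "t \<le> 2 ^ Suc k * T" for k t
    using that
  proof (induction k arbitrary: t)
    case 0
    have "\<rho> t \<le> \<rho> (2 * T) * 1"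
      using 0 T by (auto intro: le)
    also have "\<dots> \<le> \<rho> (2 * T) * (t / T) powr \<delta>"
      using 0 T assms pos[of "2 * T"] by (intro mult_left_mono ge_one_powr_ge_zero) auto
    finally show ?case .
  next
    case (Suc k)
    show ?case
    proof (cases "t \<le> 2 ^ Suc k * T")
      case True
      then show ?thesis
        by (intro Suc.IH Suc.prems(1))
    next
      case False
      have "(2::real) * T \<le> 2 ^ Suc k * T"
        using T(1) by simp
      then have t: "T \<le> t / 2" "t / 2 \<le> 2 ^ Suc k * T"
        using False Suc.prems by auto
      have "\<rho> t \<le> 2 powr \<delta> * \<rho> (t / 2)"
        using T(2)[OF t(1)] by simp
      also have "\<dots> \<le> 2 powr \<delta> * (\<rho> (2 * T) * ((t / 2) / T) powr \<delta>)"
        using Suc.IH[OF t] by (intro mult_left_mono) auto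
      also have "\<dots> = \<rho> (2 * T) * (t / T) powr \<delta>"
        using T(1) t by (simp add: powr_divide powr_mult)
      finally show ?thesis .
    qed
  qed
  note bound = this
  have "\<rho> t \<le> \<rho> (2 * T) / T powr \<delta> * t powr \<delta>" if "t \<ge> T" for t
  proof -
    obtain k where "t / T < 2 ^ k"
      using real_arch_pow[of 2 "t / T"] by auto
    also have "(2::real) ^ k \<le> 2 ^ Suc k"
      by simp
    finally have "t \<le> 2 ^ Suc k * T"
      using T(1) by (simp add: divide_simps)
    from bound[OF that this] show ?thesis
      using T(1) that by (simp add: powr_divide)
  qed
  then have "\<forall>\<^sub>F t in at_top. \<rho> t \<le> \<rho> (2 * T) / T powr \<delta> * t powr \<delta>"
    by (auto simp: eventually_at_top_linorder)
  then show ?thesis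
    using that[of "\<rho> (2 * T) / T powr \<delta>"] T(1) pos[of "2 * T"] by simp
qed

text \<open>
  The constant inside the exponent is moved into the argument.  Slow variation pays for the change
  of argument in \<open>\<rho>\<close> with a factor 2, and the integer part costs another factor 2; hence the
  dilation \<open>c / 4\<close>.
\<close>

lemma floor_ext_lesssim:
  assumes "c > 0" "C > 0" "\<forall>\<^sub>F n in sequentially. f n \<le> C * exp (- (c * (real n / \<rho> (real n))))"
  shows "floor_ext f \<lesssim> (\<lambda>t. exp (- (t / \<rho> t)))"
proof -
  have c: "c / 4 > 0"
    using assms(1) by simp
  have "\<forall>\<^sub>F t in at_top. floor_ext f t \<le> C * exp (- ((c / 4 * t) / \<rho> (c / 4 * t)))"
    using eventually_nat_floor[OF assms(3)] scaling_ge[OF c, of 2, simplified] eventually_ge_at_top[of 2]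
  proof eventually_elim
    case (elim t)
    let ?n = "real (nat \<lfloor>t\<rfloor>)"
    have n: "t / 2 \<le> ?n" "?n \<le> t"
      using elim by linarith+
    have "(c / 4 * t) / \<rho> (c / 4 * t) = c * ((t / 2) / (2 * \<rho> (c / 4 * t)))"
      by simp
    also have "\<dots> \<le> c * (?n / \<rho> ?n)"
      using n elim le[of ?n t] assms(1)
      by (intro mult_left_mono frac_le pos) auto
    finally have "C * exp (- (c * (?n / \<rho> ?n))) \<le> C * exp (- ((c / 4 * t) / \<rho> (c / 4 * t)))"
      using assms(2) by simp
    then show ?case
      using elim unfolding floor_ext_def by linarith
  qed
  then show ?thesis
    unfolding lesssim_def using assms(1,2) by (intro exI[of _ C] exI[of _ "c / 4"] conjI) auto
qed

lemma lesssim_floor_ext: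
  assumes "C > 0" "\<forall>\<^sub>F n in sequentially. exp (- (C * (real n / \<rho> (real n)))) \<le> f n"
  shows "(\<lambda>t. exp (- (t / \<rho> t))) \<lesssim> floor_ext f"
proof -
  define c where "c = 1 / (2 * C)"
  have c: "c > 0"
    using assms(1) by (simp add: c_def)
  have lim: "filterlim (\<lambda>t. c * t) at_top at_top"
    using c by real_asymp
  have c2: "\<forall>\<^sub>F t in at_top. \<rho> t \<le> 2 * \<rho> (c / 2 * t)"
    using c by (intro scaling_ge) auto
  have "\<forall>\<^sub>F t in at_top. exp (- (t / \<rho> t)) \<le> floor_ext f (c * t)"
    using eventually_compose_filterlim[OF eventually_nat_floor[OF assms(2)] lim] c2
      eventually_compose_filterlim[OF eventually_ge_at_top[of 2] lim]
      eventually_ge_at_top[of 0]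
  proof eventually_elim
    case (elim t)
    let ?n = "real (nat \<lfloor>c * t\<rfloor>)"
    have n: "c * t / 2 \<le> ?n" "?n \<le> c * t"
      using elim by linarith+
    have "C * (?n / \<rho> ?n) \<le> C * ((c * t) / (\<rho> t / 2))"
      using n elim le[of "c * t / 2" ?n] assms(1) pos[of t] c
      by (intro mult_left_mono frac_le) auto
    also have "\<dots> = t / \<rho> t"
      using assms(1) by (simp add: c_def)
    finally have "exp (- (t / \<rho> t)) \<le> exp (- (C * (?n / \<rho> ?n)))"
      by simp
    then show ?case
      using elim unfolding floor_ext_def by linarith
  qed
  then show ?thesis
    unfolding lesssim_def using c by (intro exI[of _ 1] exI[of _ c] conjI) auto
qed

end

section \<open>Stretched exponential bounds\<close>

lemma sequence_le_of_lesssim: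
  fixes f :: "nat \<Rightarrow> real"
  assumes "floor_ext f \<lesssim> (\<lambda>t. exp (- (t powr \<gamma>)))"
  obtains C c where "C > 0" "c > 0"
    "\<forall>\<^sub>F n in sequentially. f n \<le> C * exp (- (c * real n powr \<gamma>))"
proof -
  obtain c1 c2 where c: "c1 > 0" "c2 > 0"
    and le: "\<forall>\<^sub>F t in at_top. floor_ext f t \<le> c1 * exp (- ((c2 * t) powr \<gamma>))"
    using assms by (auto simp: lesssim_def)
  have "\<forall>\<^sub>F n in sequentially. f n \<le> c1 * exp (- (c2 powr \<gamma> * real n powr \<gamma>))"
    using eventually_real_sequentially[OF le] c
    by (simp add: floor_ext_def powr_mult)
  then show ?thesis
    using that[of c1 "c2 powr \<gamma>"] c by simp
qed

lemma sequence_ge_of_lesssim: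
  fixes f :: "nat \<Rightarrow> real"
  assumes "(\<lambda>t. exp (- (t powr \<gamma>))) \<lesssim> floor_ext f" "\<gamma> > 0"
  obtains K where "K > 0" "\<forall>\<^sub>F n in sequentially. exp (- (K * real n powr \<gamma>)) \<le> f n"
proof -
  obtain c1 c2 where c: "c1 > 0" "c2 > 0"
    and le: "\<forall>\<^sub>F t in at_top. exp (- (t powr \<gamma>)) \<le> c1 * floor_ext f (c2 * t)"
    using assms by (auto simp: lesssim_def)
  have "filterlim (\<lambda>s. s / c2) at_top at_top"
    using c by real_asymp
  with le have "\<forall>\<^sub>F s in at_top. exp (- ((s / c2) powr \<gamma>)) \<le> c1 * floor_ext f (c2 * (s / c2))"
    by (rule eventually_compose_filterlim)
  then have "\<forall>\<^sub>F s in at_top. exp (- ((s / c2) powr \<gamma>)) \<le> c1 * floor_ext f s"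
    using c by simp
  from eventually_real_sequentially[OF this]
  have le': "\<forall>\<^sub>F n in sequentially. exp (- ((real n / c2) powr \<gamma>)) \<le> c1 * f n"
    by (simp add: floor_ext_def)
  \<comment> \<open>The summand \<open>\<bar>ln c1\<bar>\<close> absorbs the factor \<open>c1\<close>, as \<open>n powr \<gamma> \<ge> 1\<close>.\<close>
  define K where "K = 1 / c2 powr \<gamma> + \<bar>ln c1\<bar>"
  have K: "K > 0"
    using c by (simp add: K_def add_pos_nonneg)
  have "\<forall>\<^sub>F n in sequentially. exp (- (K * real n powr \<gamma>)) \<le> f n"
    using le' eventually_ge_at_top[of 1]
  proof eventually_elim
    case (elim n)
    have "real n powr \<gamma> \<ge> 1"
      using elim assms(2) by (intro ge_one_powr_ge_zero) auto
    then have "\<bar>ln c1\<bar> * 1 \<le> \<bar>ln c1\<bar> * real n powr \<gamma>"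
      by (intro mult_left_mono) auto
    moreover have "K * real n powr \<gamma> = (real n / c2) powr \<gamma> + \<bar>ln c1\<bar> * real n powr \<gamma>"
      using c by (simp add: K_def powr_divide distrib_right)
    ultimately have "- (K * real n powr \<gamma>) \<le> - ((real n / c2) powr \<gamma>) - ln c1"
      by linarith
    then have "exp (- (K * real n powr \<gamma>)) \<le> exp (- ((real n / c2) powr \<gamma>) - ln c1)"
      by simp
    also have "\<dots> = exp (- ((real n / c2) powr \<gamma>)) / c1"
      using c by (simp add: exp_diff)
    also have "\<dots> \<le> f n"
      using elim c by (simp add: divide_simps mult.commute)
    finally show ?case .
  qed
  with K show ?thesis
    by (rule that)
qed

text \<open>
  The ratios increase, so the last one is at least their geometric mean \<open>b m powr (1 / m)\<close>.  A slow
  decay of the sequence thereby becomes a pointwise bound on its relative decrement.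
\<close>

lemma (in log_convex_sequence) one_minus_ratio_le:
  assumes "b 0 = 1" "m > 0"
  shows "1 - b (Suc m) / b m \<le> - ln (b m) / real m"
proof -
  let ?q = "b (Suc m) / b m"
  have q: "?q > 0"
    using pos by simp
  have "ln (b m) \<le> ln (?q ^ m)"
    using upper_geometric[of m] assms(1) pos[of m] q by (subst ln_le_cancel_iff) auto
  also have "\<dots> = real m * ln ?q"
    using q by (simp add: ln_realpow)
  also have "\<dots> \<le> real m * (?q - 1)"
    using q by (intro mult_left_mono ln_le_minus_one) auto
  finally show ?thesis
    using assms(2) by (simp add: field_simps)
qed

lemma exp_le_one_minus:
  fixes y :: real
  assumes "0 \<le> y" "y \<le> 1 / 2"
  shows "exp (- (2 * y)) \<le> 1 - y"
proof -
  have "y * y \<le> y * (1 / 2)"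
    using assms by (intro mult_left_mono) auto
  then have "- (2 * y) \<le> ln (1 - y)"
    using ln_one_minus_pos_lower_bound[OF assms] by (simp add: power2_eq_square)
  then show ?thesis
    using assms by (simp add: ln_ge_iff)
qed

section \<open>Extremal return probabilities\<close>

locale gauged_group = symmetric_generating_set G S + gauge: slow_gauge \<rho>
  for G :: "('a, 'b) monoid_scheme" (structure) and S :: "'a set" and \<rho> :: "real \<Rightarrow> real"
begin

text \<open>
  The weak moment is evaluated at \<open>\<rho> r / 2\<close>, a level strictly below \<open>\<rho> r\<close>; hence the factor 2.
\<close>

lemma prob_long_le:
  assumes "weak_moment G S \<rho> \<phi> \<le> ereal M" "r \<ge> 0"
  shows "measure_pmf.prob \<phi> {g \<in> carrier G. real (word_length G S g) > r} \<le> 2 * M / \<rho> r"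
proof -
  let ?s = "\<rho> r / 2"
  let ?A = "{g \<in> carrier G. \<rho> (real (word_length G S g)) > ?s}"
  have \<rho>: "\<rho> r > 0"
    using gauge.pos assms(2) .
  then have "ereal (?s * measure_pmf.prob \<phi> ?A) \<le> weak_moment G S \<rho> \<phi>"
    unfolding weak_moment_def by (intro SUP_upper) auto
  then have "ereal (?s * measure_pmf.prob \<phi> ?A) \<le> ereal M"
    using assms(1) by (rule order_trans)
  then have "measure_pmf.prob \<phi> ?A \<le> 2 * M / \<rho> r"
    using \<rho> by (simp add: field_simps)
  moreover have "{g \<in> carrier G. real (word_length G S g) > r} \<subseteq> ?A"
  proof safe
    fix g
    assume "r < real (word_length G S g)"
    then have "\<rho> r \<le> \<rho> (real (word_length G S g))"
      using assms(2) by (intro gauge.le) auto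
    then show "?s < \<rho> (real (word_length G S g))"
      using \<rho> by linarith
  qed
  then have "measure_pmf.prob \<phi> {g \<in> carrier G. real (word_length G S g) > r} \<le> measure_pmf.prob \<phi> ?A"
    by (intro measure_pmf.finite_measure_mono) auto
  ultimately show ?thesis
    by simp
qed

text \<open>
  In the bound by truncation both the time of the test walk and the number of steps are \<open>n\<close>, and the
  truncation radius is \<open>n powr ((1 - \<gamma>) / 4)\<close>.  Generators displace the test walk by a relative
  amount of order at most \<open>n powr (\<gamma> - 1)\<close>, so short steps lose at most a multiple of
  \<open>n powr ((\<gamma> - 1) / 2)\<close>, which is negligible
  against the loss of order \<open>1 / \<rho> n\<close> from long steps.  All constants are uniform in \<open>\<phi>\<close>.
\<close>

theorem return_ge_of_weak_moment:
  assumes \<gamma>: "\<gamma> < 1" and K: "K > 0" and M: "M > 0"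
    and lower: "\<forall>\<^sub>F n in sequentially. exp (- (K * real n powr \<gamma>)) \<le> return_prob G S n"
  obtains C where "C > 0"
    "\<forall>\<^sub>F n in sequentially. \<forall>\<phi>. symmetric_pmf_on G \<phi> \<and> weak_moment G S \<rho> \<phi> \<le> ereal M \<longrightarrow>
       exp (- (C * (real n / \<rho> (real n)))) \<le> pmf (conv_power G \<phi> (2 * n)) \<one>"
proof -
  \<comment> \<open>In terms of \<open>\<delta>\<close>, the displacement of a generator is \<open>n powr (- 2 \<delta>)\<close> and the squared radius is
      \<open>n powr \<delta>\<close>.\<close>
  define \<delta> where "\<delta> = (1 - \<gamma>) / 2"
  have \<delta>: "\<delta> > 0" "\<gamma> = 1 - 2 * \<delta>"
    using \<gamma> by (simp_all add: \<delta>_def field_simps)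
  obtain C1 where C1: "C1 > 0" "\<forall>\<^sub>F t in at_top. \<rho> t \<le> C1 * \<rho> (t powr (\<delta> / 2))"
    using gauge.power_ge[of "\<delta> / 2"] \<delta> by auto
  obtain C3 where C3: "C3 > 0" "\<forall>\<^sub>F t in at_top. \<rho> t \<le> C3 * t powr \<delta>"
    using gauge.sublinear[of \<delta>] \<delta> by auto
  define K' where "K' = K * 2 powr \<gamma>"
  have K': "K' > 0"
    using K by (simp add: K'_def)
  define L where "L = (real (card S))\<^sup>2 * K' * C3 + 2 * M * C1"
  have L: "L > 0"
    using K' C1 C3 M by (simp add: L_def add_nonneg_pos)
  define C where "C = K' * C3 + 4 * L"
  have C: "C > 0"
    using K' C3 L by (simp add: C_def add_pos_pos)
  have double: "filterlim (\<lambda>n::nat. 2 * n) sequentially sequentially"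
    by (rule filterlim_subseq) (simp add: strict_mono_def)
  \<comment> \<open>Keeps the loss \<open>L / \<rho> n\<close> per step below one half, where \<open>1 - y\<close> is comparable to an exponential.\<close>
  have big: "\<forall>\<^sub>F t in at_top. 2 * L \<le> \<rho> t"
    using gauge.at_top by (simp add: filterlim_at_top)
  interpret b: log_convex_sequence "\<lambda>n. return_prob G S (2 * n)"
    by (rule log_convex_return_prob)
  have b0: "return_prob G S (2 * 0) = 1"
    by (simp add: return_prob_def)
  have "\<forall>\<^sub>F n in sequentially. \<forall>\<phi>. symmetric_pmf_on G \<phi> \<and> weak_moment G S \<rho> \<phi> \<le> ereal M \<longrightarrow>
       exp (- (C * (real n / \<rho> (real n)))) \<le> pmf (conv_power G \<phi> (2 * n)) \<one>"
    using eventually_compose_filterlim[OF lower double]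
      eventually_real_sequentially[OF C1(2)] eventually_real_sequentially[OF C3(2)]
      eventually_real_sequentially[OF big] eventually_gt_at_top[of 0]
  proof eventually_elim
    case (elim n)
    define t where "t = real n"
    define b where "b = return_prob G S (2 * n)"
    define q where "q = 1 - return_prob G S (2 * Suc n) / b"
    have t: "t > 0" "t \<ge> 1"
      using elim by (simp_all add: t_def)
    have \<rho>: "\<rho> t > 0"
      using t by (intro gauge.pos) simp
    have C3t: "\<rho> t \<le> C3 * t powr \<delta>" and C1t: "\<rho> t \<le> C1 * \<rho> (t powr (\<delta> / 2))"
      and Lt: "2 * L \<le> \<rho> t"
      using elim by (simp_all add: t_def)
    have decay: "t powr (- \<delta>) \<le> C3 / \<rho> t"
      using C3t t \<rho> by (simp add: powr_minus field_simps)
    have b_ge: "exp (- (K' * t powr \<gamma>)) \<le> b"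
      using elim(1) by (simp add: b_def t_def K'_def powr_mult mult.assoc)
    have b_pos: "b > 0"
      using b.pos[of n] by (simp add: b_def)
    have "- (K' * t powr \<gamma>) \<le> ln b"
      using b_ge b_pos by (simp add: ln_ge_iff)
    then have "- ln b / t \<le> K' * t powr \<gamma> / t"
      using t by (intro divide_right_mono) auto
    moreover have "q \<le> - ln b / t"
      using b.one_minus_ratio_le[OF b0, of n] elim by (simp add: q_def b_def t_def)
    moreover have "t powr \<gamma> / t = t powr (- (2 * \<delta>))"
      using t powr_diff[of t \<gamma> 1] by (simp add: \<delta>(2))
    ultimately have q: "q \<le> K' * t powr (- (2 * \<delta>))"
      by (simp flip: times_divide_eq_right)
    show ?case
    proof (intro allI impI, elim conjE)
      fix \<phi>
      assume \<phi>: "symmetric_pmf_on G \<phi>" "weak_moment G S \<rho> \<phi> \<le> ereal M"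
      let ?r = "t powr (\<delta> / 2)"
      define x where "x = ?r\<^sup>2 * (real (card S))\<^sup>2 * q
        + measure_pmf.prob \<phi> {g \<in> carrier G. real (word_length G S g) > ?r}"
      have r2: "?r\<^sup>2 = t powr \<delta>"
        using t by (simp add: powr_power)
      have e: "t powr (- \<delta>) = t powr \<delta> * t powr (- (2 * \<delta>))"
        by (simp flip: powr_add)
      have "?r\<^sup>2 * (real (card S))\<^sup>2 * q \<le> ?r\<^sup>2 * (real (card S))\<^sup>2 * (K' * t powr (- (2 * \<delta>)))"
        using q by (intro mult_left_mono) auto
      also have "\<dots> = (real (card S))\<^sup>2 * K' * t powr (- \<delta>)"
        unfolding r2 e by (simp only: mult_ac)
      also have "\<dots> \<le> (real (card S))\<^sup>2 * K' * (C3 / \<rho> t)"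
        using decay K' by (intro mult_left_mono) auto
      finally have "?r\<^sup>2 * (real (card S))\<^sup>2 * q \<le> (real (card S))\<^sup>2 * K' * (C3 / \<rho> t)" .
      moreover have "measure_pmf.prob \<phi> {g \<in> carrier G. real (word_length G S g) > ?r} \<le> 2 * M / \<rho> ?r"
        using \<phi>(2) by (rule prob_long_le) simp
      moreover have "2 * M / \<rho> ?r \<le> 2 * M * (C1 / \<rho> t)"
        using C1t M \<rho> gauge.pos[of ?r] by (simp add: field_simps)
      ultimately have "x \<le> (real (card S))\<^sup>2 * K' * (C3 / \<rho> t) + 2 * M * (C1 / \<rho> t)"
        unfolding x_def by linarith
      also have "\<dots> = L / \<rho> t"
        by (simp add: L_def add_divide_distrib)
      finally have x: "x \<le> L / \<rho> t" .
      have half: "L / \<rho> t \<le> 1 / 2"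
        using Lt \<rho> by (simp add: field_simps)
      then have le_one: "L / \<rho> t \<le> 1"
        by linarith
      with x have x_le: "x \<le> 1"
        by (rule order_trans)
      have n_le: "t powr \<gamma> \<le> C3 * (t / \<rho> t)"
      proof -
        have "t powr \<gamma> = t powr (1 + - \<delta> + - \<delta>)"
          by (simp add: \<delta>(2))
        also have "\<dots> = t * t powr (- \<delta>) * t powr (- \<delta>)"
          using t by (simp only: powr_add powr_one)
        also have "\<dots> \<le> t * (C3 / \<rho> t) * 1"
          using decay t C3(1) \<rho> powr_mono[of "- \<delta>" 0 t] \<delta>(1) by (intro mult_mono) auto
        finally show ?thesis
          by (simp add: mult_ac)
      qed
      have "exp (- (C * (t / \<rho> t))) = exp (- (K' * (C3 * (t / \<rho> t)))) * exp (- (2 * (L / \<rho> t))) ^ (2 * n)"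
        unfolding exp_of_nat_mult[symmetric] exp_add[symmetric]
        by (rule arg_cong[where f = exp]) (simp add: C_def t_def algebra_simps add_divide_distrib)
      also have "\<dots> \<le> b * (1 - L / \<rho> t) ^ (2 * n)"
      proof (intro mult_mono power_mono)
        have "K' * t powr \<gamma> \<le> K' * (C3 * (t / \<rho> t))"
          by (rule mult_left_mono[OF n_le less_imp_le[OF K']])
        then have "exp (- (K' * (C3 * (t / \<rho> t)))) \<le> exp (- (K' * t powr \<gamma>))"
          by (simp only: exp_le_cancel_iff neg_le_iff_le)
        then show "exp (- (K' * (C3 * (t / \<rho> t)))) \<le> b"
          using b_ge by (rule order_trans)
        show "exp (- (2 * (L / \<rho> t))) \<le> 1 - L / \<rho> t"
          using half L \<rho> by (intro exp_le_one_minus) auto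
      qed (use b_pos in auto)
      also have "\<dots> \<le> b * (1 - x) ^ (2 * n)"
        using x le_one b_pos by (intro mult_left_mono power_mono) simp_all
      also have "\<dots> \<le> pmf (conv_power G \<phi> (2 * n)) \<one>"
        using return_ge_truncation[OF \<phi>(1) _ x_le[unfolded x_def b_def q_def], of n]
        unfolding x_def b_def q_def by simp
      finally show "exp (- (C * (real n / \<rho> (real n)))) \<le> pmf (conv_power G \<phi> (2 * n)) \<one>"
        by (simp add: t_def)
    qed
  qed
  with C show ?thesis
    by (rule that)
qed

text \<open>
  The extremal step distribution: a simple walk run for a random time \<open>N\<close> with tail \<open>1 / \<rho>\<close>.  With
  \<open>r\<close> of order \<open>n powr (2 / \<gamma>)\<close>, the walk that survives \<open>2 n\<close> steps without any time exceeding \<open>r\<close>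
  has probability at most \<open>exp (- 2 n / \<rho> r)\<close>, and \<open>\<rho> r\<close> is comparable to \<open>\<rho> n\<close>.  Otherwise the simple
  walk has run long enough for its return probability to be at most of order \<open>exp (- c n)\<close>.
\<close>

theorem ex_return_le_of_weak_moment:
  assumes \<gamma>: "\<gamma> > 0" and c: "c > 0" and C: "C > 0"
    and upper: "\<forall>\<^sub>F n in sequentially. return_prob G S n \<le> C * exp (- (c * real n powr \<gamma>))"
  obtains \<phi> c' where "symmetric_pmf_on G \<phi>" "weak_moment G S \<rho> \<phi> \<le> ereal (\<rho> 0)" "c' > 0"
    "\<forall>\<^sub>F n in sequentially.
       pmf (conv_power G \<phi> (2 * n)) \<one> \<le> (1 + C) * exp (- (c' * (real n / \<rho> (real n))))"
proof -
  define F where "F r = (if r = 0 then 1 else 1 / \<rho> (real r))" for r :: nat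
  have "decseq F"
    using gauge.ge_one gauge.le[of "real i" "real (Suc i)" for i] gauge.pos
    by (auto simp: decseq_Suc_iff F_def intro!: divide_left_mono mult_pos_pos)
  moreover have "F \<longlonglongrightarrow> 0"
  proof -
    have "filterlim (\<lambda>r. \<rho> (real r)) at_top sequentially"
      using gauge.at_top filterlim_real_sequentially by (rule filterlim_compose)
    then have "(\<lambda>r. inverse (\<rho> (real r))) \<longlonglongrightarrow> 0"
      by (rule tendsto_inverse_0_at_top)
    moreover have "\<forall>\<^sub>F r in sequentially. inverse (\<rho> (real r)) = F r"
      using eventually_gt_at_top[of 0] by eventually_elim (simp add: F_def inverse_eq_divide)
    ultimately show ?thesis
      by (rule Lim_transform_eventually)
  qed
  ultimately obtain N where N: "\<And>r. measure_pmf.prob N {r..} = F r"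
    using ex_nat_pmf_with_tail[of F] by (auto simp: F_def)
  define \<phi> where "\<phi> = bind_pmf N simple_walk"
  have sym: "symmetric_pmf_on G \<phi>"
    unfolding \<phi>_def by (rule symmetric_mixture[OF symmetric_pmf_of_set])
  have moment: "weak_moment G S \<rho> \<phi> \<le> ereal (\<rho> 0)"
    unfolding \<phi>_def using gauge.ge_one gauge.mono gauge.at_top
    by (rule weak_moment_mixture_le) (simp_all add: N F_def)
  obtain C1 where C1: "C1 > 0" "\<forall>\<^sub>F t in at_top. \<rho> (t powr (2 / \<gamma>)) \<le> C1 * \<rho> t"
    using gauge.power_le[of "2 / \<gamma>"] \<gamma> by auto
  obtain J where J: "\<And>j. j \<ge> J \<Longrightarrow> return_prob G S j \<le> C * exp (- (c * real j powr \<gamma>))"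
    using upper by (auto simp: eventually_sequentially)
  define c' where "c' = min c (2 / C1)"
  have c': "c' > 0" "c' \<le> c" "c' \<le> 2 / C1"
    using c C1 by (auto simp: c'_def)
  have "filterlim (\<lambda>t::real. t powr (1 / \<gamma>)) at_top at_top"
    using \<gamma> by real_asymp
  then have large: "\<forall>\<^sub>F t::real in at_top. max 2 (real J) \<le> t powr (1 / \<gamma>)"
    unfolding filterlim_at_top by blast
  have "\<forall>\<^sub>F n in sequentially.
       pmf (conv_power G \<phi> (2 * n)) \<one> \<le> (1 + C) * exp (- (c' * (real n / \<rho> (real n))))"
    using eventually_real_sequentially[OF C1(2)] eventually_real_sequentially[OF large]
      eventually_gt_at_top[of 0]
  proof eventually_elim
    case (elim n)
    define t where "t = real n"
    define y where "y = t powr (1 / \<gamma>)"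
    \<comment> \<open>Squaring leaves room for the integer part: \<open>y \<le> r \<le> y\<^sup>2\<close>, while \<open>y powr \<gamma> = n\<close>.\<close>
    define r where "r = nat \<lfloor>y\<^sup>2\<rfloor>"
    have t: "t > 0"
      using elim by (simp add: t_def)
    have \<rho>: "\<rho> t \<ge> 1"
      using t by (intro gauge.ge_one) simp
    have y: "y \<ge> 2" "y \<ge> real J"
      using elim by (simp_all add: y_def t_def)
    have "y * 2 \<le> y * y"
      using y by (intro mult_left_mono) auto
    then have "y\<^sup>2 - 1 \<ge> y"
      unfolding power2_eq_square using y by linarith
    moreover have "real r \<ge> y\<^sup>2 - 1" "real r \<le> y\<^sup>2"
      unfolding r_def using zero_le_power2[of y] by linarith+
    ultimately have r: "y \<le> real r" "real r \<le> y\<^sup>2"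
      by linarith+
    have y2: "y\<^sup>2 = t powr (2 / \<gamma>)"
      using t by (simp add: y_def powr_power)
    have y\<gamma>: "y powr \<gamma> = t"
      using t \<gamma> by (simp add: y_def powr_powr)
    have "\<rho> (real r) \<le> \<rho> (y\<^sup>2)"
      using r by (intro gauge.le) auto
    also have "\<dots> \<le> C1 * \<rho> t"
      using elim(1) by (simp add: y2 t_def)
    finally have \<rho>r: "\<rho> (real r) \<le> C1 * \<rho> t" .
    have \<rho>r_ge: "\<rho> (real r) \<ge> 1"
      by (rule gauge.ge_one) simp
    have small: "pmf (simple_walk j) \<one> \<le> C * exp (- (c * t))" if "j \<ge> r" for j
    proof -
      have "y \<le> real j" "j \<ge> J"
        using that r y by linarith+
      then have "t \<le> real j powr \<gamma>"
        using powr_mono2[of \<gamma> y "real j"] y \<gamma> y\<gamma> by simp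
      then have "C * exp (- (c * real j powr \<gamma>)) \<le> C * exp (- (c * t))"
        using c C by simp
      with J[OF \<open>j \<ge> J\<close>] show ?thesis
        by (simp add: return_prob_def)
    qed
    have "r > 0"
      using r y by linarith
    have "measure_pmf.prob N {..<r} = 1 - 1 / \<rho> (real r)"
    proof -
      have "{..<r} = UNIV - {r..}"
        by auto
      then show ?thesis
        using measure_pmf.prob_compl[of "{r..}" N] \<open>r > 0\<close> by (simp add: N F_def)
    qed
    also have "\<dots> \<le> exp (- (1 / \<rho> (real r)))"
      using exp_ge_add_one_self[of "- (1 / \<rho> (real r))"] by simp
    finally have "measure_pmf.prob N {..<r} ^ (2 * n) \<le> exp (- (1 / \<rho> (real r))) ^ (2 * n)"
      by (intro power_mono) auto
    also have "\<dots> = exp (- (2 * t / \<rho> (real r)))"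
      unfolding exp_of_nat_mult[symmetric] by (simp add: t_def)
    also have "\<dots> \<le> exp (- (c' * (t / \<rho> t)))"
    proof -
      have "c' * (t / \<rho> t) \<le> (2 / C1) * (t / \<rho> t)"
        using c' t \<rho> by (intro mult_right_mono) auto
      also have "\<dots> = 2 * t / (C1 * \<rho> t)"
        by simp
      also have "\<dots> \<le> 2 * t / \<rho> (real r)"
        using \<rho>r \<rho>r_ge t \<rho> C1(1) by (intro divide_left_mono mult_pos_pos) auto
      finally show ?thesis
        by simp
    qed
    finally have near: "measure_pmf.prob N {..<r} ^ (2 * n) \<le> exp (- (c' * (t / \<rho> t)))" .
    have "c' * (t / \<rho> t) \<le> c * t"
      using c' c t \<rho> by (intro mult_mono) (auto simp: divide_le_eq mult_le_cancel_left1)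
    then have far: "C * exp (- (c * t)) \<le> C * exp (- (c' * (t / \<rho> t)))"
      using C by simp
    have "pmf (conv_power G \<phi> (2 * n)) \<one> \<le> measure_pmf.prob N {..<r} ^ (2 * n) + C * exp (- (c * t))"
      unfolding \<phi>_def
      by (intro return_mixture_le small) (simp add: set_pmf_of_S S_subset)
    also have "\<dots> \<le> (1 + C) * exp (- (c' * (t / \<rho> t)))"
      using near far by (simp add: algebra_simps)
    finally show ?case
      by (simp add: t_def)
  qed
  with sym moment c'(1) show ?thesis
    by (rule that)
qed

theorem extremal_return_prob_simeq:
  assumes "0 < \<gamma>\<^sub>1" "0 < \<gamma>\<^sub>2" "\<gamma>\<^sub>2 < 1"
    and "(\<lambda>t. exp (- (t powr \<gamma>\<^sub>2))) \<lesssim> floor_ext (return_prob G S)"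
    and "floor_ext (return_prob G S) \<lesssim> (\<lambda>t. exp (- (t powr \<gamma>\<^sub>1)))"
  shows "floor_ext (extremal_return_prob G S \<rho>) \<simeq> (\<lambda>t. exp (- (t / \<rho> t)))"
proof -
  let ?V = "\<lambda>n. {pmf (conv_power G \<phi> (2 * n)) \<one> | \<phi>.
    symmetric_pmf_on G \<phi> \<and> weak_moment G S \<rho> \<phi> \<le> ereal (2 * \<rho> 0)}"
  have \<rho>0: "\<rho> 0 > 0"
    by (rule gauge.pos) simp
  obtain C c where C: "C > 0" "c > 0"
    "\<forall>\<^sub>F n in sequentially. return_prob G S n \<le> C * exp (- (c * real n powr \<gamma>\<^sub>1))"
    using sequence_le_of_lesssim[OF assms(5)] .
  obtain \<phi> c' where \<phi>: "symmetric_pmf_on G \<phi>" "weak_moment G S \<rho> \<phi> \<le> ereal (\<rho> 0)"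
    and c': "c' > 0" "\<forall>\<^sub>F n in sequentially.
       pmf (conv_power G \<phi> (2 * n)) \<one> \<le> (1 + C) * exp (- (c' * (real n / \<rho> (real n))))"
    using ex_return_le_of_weak_moment[OF assms(1) C(2,1,3)] .
  have "ereal (\<rho> 0) \<le> ereal (2 * \<rho> 0)"
    using \<rho>0 by simp
  then have mem: "pmf (conv_power G \<phi> (2 * n)) \<one> \<in> ?V n" for n
    using \<phi> order_trans by blast
  have bdd: "bdd_below (?V n)" for n
    by (rule bdd_belowI[of _ 0]) auto
  have "\<forall>\<^sub>F n in sequentially. extremal_return_prob G S \<rho> n
      \<le> (1 + C) * exp (- (c' * (real n / \<rho> (real n))))"
    using c'(2)
  proof eventually_elim
    case (elim n)
    then show ?case
      unfolding extremal_return_prob_def using cInf_lower[OF mem bdd, of n] by linarith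
  qed
  then have upper: "floor_ext (extremal_return_prob G S \<rho>) \<lesssim> (\<lambda>t. exp (- (t / \<rho> t)))"
    using C(1) c'(1) by (intro gauge.floor_ext_lesssim[of c' "1 + C"]) auto
  obtain K where K: "K > 0"
    "\<forall>\<^sub>F n in sequentially. exp (- (K * real n powr \<gamma>\<^sub>2)) \<le> return_prob G S n"
    using sequence_ge_of_lesssim[OF assms(4,2)] .
  have M: "2 * \<rho> 0 > 0"
    using \<rho>0 by simp
  obtain C' where C': "C' > 0"
    "\<forall>\<^sub>F n in sequentially. \<forall>\<phi>. symmetric_pmf_on G \<phi> \<and> weak_moment G S \<rho> \<phi> \<le> ereal (2 * \<rho> 0) \<longrightarrow>
       exp (- (C' * (real n / \<rho> (real n)))) \<le> pmf (conv_power G \<phi> (2 * n)) \<one>"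
    using return_ge_of_weak_moment[OF assms(3) K(1) M K(2)] .
  have "\<forall>\<^sub>F n in sequentially.
      exp (- (C' * (real n / \<rho> (real n)))) \<le> extremal_return_prob G S \<rho> n"
    using C'(2)
  proof eventually_elim
    case (elim n)
    then show ?case
      unfolding extremal_return_prob_def using mem[of n] by (intro cInf_greatest) auto
  qed
  then have "(\<lambda>t. exp (- (t / \<rho> t))) \<lesssim> floor_ext (extremal_return_prob G S \<rho>)"
    by (rule gauge.lesssim_floor_ext[OF C'(1)])
  with upper show ?thesis
    by (simp add: simeq_growth_def)
qed

end

theorem corollary3p6:
  fixes G :: "('a, 'b) monoid_scheme" and S :: "'a set"
    and \<gamma>\<^sub>1 \<gamma>\<^sub>2 :: real and \<rho> l :: "real \<Rightarrow> real"
  assumes "group G"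
    and "finite S" and "S \<subseteq> carrier G" and "\<one>\<^bsub>G\<^esub> \<in> S"
    and "\<And>s. s \<in> S \<Longrightarrow> inv\<^bsub>G\<^esub> s \<in> S"
    and "generate G S = carrier G"
    and "0 < \<gamma>\<^sub>1" and "\<gamma>\<^sub>1 \<le> \<gamma>\<^sub>2" and "\<gamma>\<^sub>2 < 1"
    and "(\<lambda>t. exp (- (t powr \<gamma>\<^sub>2))) \<lesssim> floor_ext (return_prob G S)"
    and "floor_ext (return_prob G S) \<lesssim> (\<lambda>t. exp (- (t powr \<gamma>\<^sub>1)))"
    and "\<And>t. t \<ge> 0 \<Longrightarrow> \<rho> t \<ge> 1" and "continuous_on {0..} \<rho>" and "mono_on {0..} \<rho>"
    and "\<And>t. t \<ge> 0 \<Longrightarrow> l t \<ge> 1" and "continuous_on {0..} l" and "mono_on {0..} l"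
    and "\<exists>\<alpha>\<ge>0. regularly_varying l \<alpha>"
    and "set_integrable lborel {0..} (\<lambda>s. 1 / ((1 + s) * l s))"
    and "\<rho> \<simeq> (\<lambda>t. inverse (LBINT s:{t..}. 1 / ((1 + s) * l s)))"
    and "slowly_varying \<rho>"
    and "\<And>a. a > 0 \<Longrightarrow> (\<lambda>t. \<rho> (t powr a)) \<simeq> \<rho>"
  shows "floor_ext (extremal_return_prob G S \<rho>) \<simeq> (\<lambda>t. exp (- (t / \<rho> t)))"
proof -
  let ?f = "\<lambda>s. 1 / ((1 + s) * l s)"
  have "?f s > 0" if "s \<ge> 0" for s
    using assms(15)[OF that] that by (intro divide_pos_pos mult_pos_pos) auto
  then have "\<forall>\<^sub>F t in at_top. (LBINT s:{t..}. ?f s) > 0"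
    by (intro eventually_mono[OF eventually_ge_at_top[of "0::real"]] tail_integral_pos[OF assms(19)])
  with tail_integral_tendsto_0[OF assms(19)]
  have "filterlim (\<lambda>t. inverse (LBINT s:{t..}. ?f s)) at_top at_top"
    by (rule filterlim_inverse_at_top)
  \<comment> \<open>The integral representation makes \<open>\<rho>\<close> unbounded.\<close>
  then have "filterlim \<rho> at_top at_top"
    using at_top_of_lesssim assms(20) unfolding simeq_growth_def by metis
  moreover have "(\<lambda>t. \<rho> (t powr a)) \<lesssim> \<rho>" if "a > 0" for a
    using assms(22)[OF that] by (simp add: simeq_growth_def)
  ultimately have "slow_gauge \<rho>"
    using assms by (intro slow_gauge.intro) auto
  moreover have "symmetric_generating_set G S"
    using assms by (intro symmetric_generating_set.intro symmetric_generating_set_axioms.intro) auto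
  ultimately interpret gauged_group G S \<rho>
    by (intro gauged_group.intro)
  show ?thesis
    using assms(7-9) by (intro extremal_return_prob_simeq[OF _ _ _ assms(10,11)]) auto
qed

end
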